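(* Let $(A,p_l)$ be a Fréchet algebra with a bounded approximate identity. Then for each $n\in\mathbb{N}$, the Fréchet algebra $A^{\#}$ is $(2n+1)$-weakly amenable if and only if $A$ is $(2n+1)$-weakly amenable.
   Context: All spaces are complex and $\mathbb{N}=\{1,2,\dots\}$. A Fréchet algebra $(A,p_l)$ is an algebra that is complete and Hausdorff for the topology generated by a separating, increasing sequence $(p_l)_{l\in\mathbb{N}}$ of submultiplicative seminorms. A bounded approximate identity is a bounded net $(e_\alpha)$ in $A$ with $e_\alpha a\to a$ and $ae_\alpha\to a$ for all $a\in A$. The unitization of $A$ is $A^{\#}=A\oplus\mathbb{C}e$ with product $(a,\lambda)(b,\mu)=(ab+\mu a+\lambda b,\lambda\mu)$ and seminorms $q_l(a,\lambda)=p_l(a)+|\lambda|$; it is a Fréchet algebra with identity $e=(0,1)$. For a locally convex space $X$, $X^*$ is its continuous dual with the strong topology (uniform convergence on bounded subsets of $X$); $X^{(0)}=X$ and $X^{(n)}=(X^{(n-1)})^*$. If $B$ is a Fréchet algebra and $X$ a locally convex $B$-bimodule, then $X^*$ is a $B$-bimodule via $\langle b\cdot f,x\rangle=\langle f,x\cdot b\rangle$ and $\langle f\cdot b,x\rangle=\langle f,b\cdot x\rangle$; iterating, every $X^{(n)}$ is a $B$-bimodule. $B$ is a bimodule over itself by multiplication. A continuous derivation $D:B\to X$ is a continuous linear map with $D(ab)=a\cdot D(b)+D(a)\cdot b$ for all $a,b\in B$; it is inner if there is $x\in X$ with $D(b)=b\cdot x-x\cdot b$ for all $b\in B$. $B$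 is $n$-weakly amenable if every continuous derivation $B\to B^{(n)}$ is inner. *)

theory Defs
  imports "HOL-Analysis.Analysis"
begin

section \<open>Complex algebras, Frechet algebras and unitization\<close>

text \<open>Algebras are associative but not assumed to have an identity
  (the class \<^class>\<open>ring\<close> is the class of non-unital rings).\<close>

class complex_algebra = ring +
  fixes scaleC :: "complex \<Rightarrow> 'a \<Rightarrow> 'a"
  assumes scaleC_add_right: "scaleC c (x + y) = scaleC c x + scaleC c y"
    and scaleC_add_left: "scaleC (c + d) x = scaleC c x + scaleC d x"
    and scaleC_scaleC: "scaleC c (scaleC d x) = scaleC (c * d) x"
    and scaleC_one: "scaleC 1 x = x"
    and mult_scaleC_left: "scaleC c x * y = scaleC c (x * y)"
    and mult_scaleC_right: "x * scaleC c y = scaleC c (x * y)"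

lemma vector_space_scaleC: "vector_space (scaleC :: complex \<Rightarrow> 'a \<Rightarrow> 'a::complex_algebra)"
  by unfold_locales
    (simp_all add: scaleC_add_right scaleC_add_left scaleC_scaleC scaleC_one)

definition submult_seminorm :: "('a::complex_algebra \<Rightarrow> real) \<Rightarrow> bool" where
  "submult_seminorm q \<longleftrightarrow>
     (\<forall>x y. q (x + y) \<le> q x + q y) \<and>
     (\<forall>c x. q (scaleC c x) = cmod c * q x) \<and>
     (\<forall>x y. q (x * y) \<le> q x * q y)"

definition cauchy_filter_wrt :: "(nat \<Rightarrow> 'a::complex_algebra \<Rightarrow> real) \<Rightarrow> 'a filter \<Rightarrow> bool" where
  "cauchy_filter_wrt p F \<longleftrightarrow>
     (\<forall>l. \<forall>r>0. \<exists>S. eventually (\<lambda>x. x \<in> S) F \<and> (\<forall>x\<in>S. \<forall>y\<in>S. p l (x - y) < r))"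

text \<open>The topology generated by \<open>p\<close> is Hausdorff exactly because \<open>p\<close> is separating.
  Completeness is convergence of all proper Cauchy filters (equivalently, nets).\<close>

definition frechet_algebra :: "(nat \<Rightarrow> 'a::complex_algebra \<Rightarrow> real) \<Rightarrow> bool" where
  "frechet_algebra p \<longleftrightarrow>
     (\<forall>l. submult_seminorm (p l)) \<and>
     (\<forall>l x. p l x \<le> p (Suc l) x) \<and>
     (\<forall>x. (\<forall>l. p l x = 0) \<longrightarrow> x = 0) \<and>
     (\<forall>F. F \<noteq> bot \<and> cauchy_filter_wrt p F \<longrightarrow>
        (\<exists>x. \<forall>l. ((\<lambda>y. p l (y - x)) \<longlongrightarrow> 0) F))"

text \<open>Nets are indexed by a (nonempty) type with a directed preorder \<open>le\<close>.\<close>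

definition directed_preorder :: "('i \<Rightarrow> 'i \<Rightarrow> bool) \<Rightarrow> bool" where
  "directed_preorder le \<longleftrightarrow>
     (\<forall>i. le i i) \<and>
     (\<forall>i j k. le i j \<and> le j k \<longrightarrow> le i k) \<and>
     (\<forall>i j. \<exists>k. le i k \<and> le j k)"

definition bounded_approximate_identity ::
    "(nat \<Rightarrow> 'a::complex_algebra \<Rightarrow> real) \<Rightarrow> ('i \<Rightarrow> 'i \<Rightarrow> bool) \<Rightarrow> ('i \<Rightarrow> 'a) \<Rightarrow> bool" where
  "bounded_approximate_identity p le u \<longleftrightarrow>
     directed_preorder le \<and>
     (\<forall>l. \<exists>C. \<forall>i. p l (u i) \<le> C) \<and>
     (\<forall>a l. \<forall>r>0. \<exists>j. \<forall>i. le j i \<longrightarrow> p l (u i * a - a) < r) \<and>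
     (\<forall>a l. \<forall>r>0. \<exists>j. \<forall>i. le j i \<longrightarrow> p l (a * u i - a) < r)"

datatype 'a unitization = Unitization (algebra_part: 'a) (scalar_part: complex)

instantiation unitization :: (complex_algebra) complex_algebra
begin

definition "0 = Unitization 0 0"
definition "x + y = Unitization (algebra_part x + algebra_part y) (scalar_part x + scalar_part y)"
definition "x - y = Unitization (algebra_part x - algebra_part y) (scalar_part x - scalar_part y)"
definition "- x = Unitization (- algebra_part x) (- scalar_part x)"
definition "scaleC c x = Unitization (scaleC c (algebra_part x)) (c * scalar_part x)"
definition "x * y =
  Unitization
    (algebra_part x * algebra_part y
      + scaleC (scalar_part y) (algebra_part x) + scaleC (scalar_part x) (algebra_part y))
    (scalar_part x * scalar_part y)"

instance
  by intro_classes
    (simp_all add: zero_unitization_def plus_unitization_def minus_unitization_def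
      uminus_unitization_def scaleC_unitization_def times_unitization_def
      scaleC_add_right scaleC_add_left scaleC_scaleC scaleC_one mult_scaleC_left
      mult_scaleC_right algebra_simps)

end

definition unitization_seminorm ::
    "(nat \<Rightarrow> 'a::complex_algebra \<Rightarrow> real) \<Rightarrow> nat \<Rightarrow> 'a unitization \<Rightarrow> real" where
  "unitization_seminorm p l x = p l (algebra_part x) + cmod (scalar_part x)"


section \<open>Locally convex bimodules and strong duals\<close>

text \<open>A locally convex bimodule, with elements in a subset of the type \<open>'x\<close>, over an algebra of
  type \<open>'b\<close>; its topology is given by a generating family of seminorms.  The record only
  carries the data; values of the operations outside the carrier are irrelevant.\<close>

record ('b, 'x) lc_bimodule =
  bm_carrier :: "'x set"
  bm_add :: "'x \<Rightarrow> 'x \<Rightarrow> 'x"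
  bm_scale :: "complex \<Rightarrow> 'x \<Rightarrow> 'x"
  bm_left :: "'b \<Rightarrow> 'x \<Rightarrow> 'x"
  bm_right :: "'x \<Rightarrow> 'b \<Rightarrow> 'x"
  bm_seminorms :: "('x \<Rightarrow> real) set"

definition bm_diff :: "('b, 'x) lc_bimodule \<Rightarrow> 'x \<Rightarrow> 'x \<Rightarrow> 'x" where
  "bm_diff X x y = bm_add X x (bm_scale X (- 1) y)"

definition bm_topology :: "('b, 'x) lc_bimodule \<Rightarrow> 'x topology" where
  "bm_topology X = topology_generated_by
     {{y \<in> bm_carrier X. q (bm_diff X y x) < r} | q x r.
        q \<in> bm_seminorms X \<and> x \<in> bm_carrier X \<and> 0 < r}"

definition bm_bounded :: "('b, 'x) lc_bimodule \<Rightarrow> 'x set \<Rightarrow> bool" where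
  "bm_bounded X S \<longleftrightarrow> S \<subseteq> bm_carrier X \<and> (\<forall>q\<in>bm_seminorms X. bdd_above (q ` S))"

text \<open>Functionals on a bimodule are functions on its carrier, made total by the library's
  convention for extensional functions.\<close>

definition continuous_functionals :: "('b, 'x) lc_bimodule \<Rightarrow> ('x \<Rightarrow> complex) set" where
  "continuous_functionals X =
     {f \<in> extensional (bm_carrier X).
        (\<forall>x\<in>bm_carrier X. \<forall>y\<in>bm_carrier X. f (bm_add X x y) = f x + f y) \<and>
        (\<forall>c. \<forall>x\<in>bm_carrier X. f (bm_scale X c x) = c * f x) \<and>
        continuous_map (bm_topology X) euclidean f}"

definition strong_dual :: "('b, 'x) lc_bimodule \<Rightarrow> ('b, 'x \<Rightarrow> complex) lc_bimodule" where
  "strong_dual X =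
     \<lparr>bm_carrier = continuous_functionals X,
      bm_add = (\<lambda>f g. \<lambda>x\<in>bm_carrier X. f x + g x),
      bm_scale = (\<lambda>c f. \<lambda>x\<in>bm_carrier X. c * f x),
      bm_left = (\<lambda>b f. \<lambda>x\<in>bm_carrier X. f (bm_right X x b)),
      bm_right = (\<lambda>f b. \<lambda>x\<in>bm_carrier X. f (bm_left X b x)),
      bm_seminorms = {\<lambda>f. SUP x\<in>S. cmod (f x) | S. S \<noteq> {} \<and> bm_bounded X S}\<rparr>"

definition regular_bimodule ::
    "(nat \<Rightarrow> 'b::complex_algebra \<Rightarrow> real) \<Rightarrow> ('b, 'b) lc_bimodule" where
  "regular_bimodule p =
     \<lparr>bm_carrier = UNIV, bm_add = (+), bm_scale = scaleC,
      bm_left = (*), bm_right = (*), bm_seminorms = range p\<rparr>"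


section \<open>Iterated duals\<close>

text \<open>The isomorphic copy of a bimodule obtained by renaming its elements along \<open>h\<close>
  (injective on the carrier).\<close>

definition rename_bimodule :: "('x \<Rightarrow> 'y) \<Rightarrow> ('b, 'x) lc_bimodule \<Rightarrow> ('b, 'y) lc_bimodule" where
  "rename_bimodule h X =
     (let g = the_inv_into (bm_carrier X) h in
      \<lparr>bm_carrier = h ` bm_carrier X,
       bm_add = (\<lambda>x y. h (bm_add X (g x) (g y))),
       bm_scale = (\<lambda>c x. h (bm_scale X c (g x))),
       bm_left = (\<lambda>b x. h (bm_left X b (g x))),
       bm_right = (\<lambda>x b. h (bm_right X (g x) b)),
       bm_seminorms = (\<lambda>q. q \<circ> g) ` bm_seminorms X\<rparr>)"

text \<open>The iterated duals \<open>X\<^sup>(\<^sup>0\<^sup>) = X\<close>, \<open>X\<^sup>(\<^sup>1\<^sup>)\<close>, \<open>X\<^sup>(\<^sup>2\<^sup>)\<close>, ... are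
  sets of functionals of ever higher type, so they do not form one HOL function of the number of
  dualizations.  They are therefore copied into one type \<open>'u\<close> along encodings:
  \<open>e\<close> encodes the elements of \<open>X\<close>, and \<open>c k\<close> encodes the continuous functionals on
  the copy of \<open>X\<^sup>(\<^sup>k\<^sup>)\<close> as elements of \<open>'u\<close>.\<close>

primrec iterated_dual ::
    "('x \<Rightarrow> 'u) \<Rightarrow> (nat \<Rightarrow> ('u \<Rightarrow> complex) \<Rightarrow> 'u) \<Rightarrow> ('b, 'x) lc_bimodule \<Rightarrow> nat
      \<Rightarrow> ('b, 'u) lc_bimodule" where
  "iterated_dual e c X 0 = rename_bimodule e X"
| "iterated_dual e c X (Suc k) = rename_bimodule (c k) (strong_dual (iterated_dual e c X k))"

text \<open>The encodings are faithful up to the \<open>n\<close>-th dual.  By the lemmas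
  \<open>encodes_duals_0\<close> and \<open>encodes_duals_Suc\<close> below, every \<open>X\<close> and \<open>n\<close> have such encodings
  in some type \<open>'u\<close>.\<close>

definition encodes_duals ::
    "('x \<Rightarrow> 'u) \<Rightarrow> (nat \<Rightarrow> ('u \<Rightarrow> complex) \<Rightarrow> 'u) \<Rightarrow> ('b, 'x) lc_bimodule \<Rightarrow> nat \<Rightarrow> bool" where
  "encodes_duals e c X n \<longleftrightarrow>
     inj_on e (bm_carrier X) \<and>
     (\<forall>k<n. inj_on (c k) (continuous_functionals (iterated_dual e c X k)))"


text \<open>A type \<open>'u\<close> with encodings up to the \<open>n\<close>-th dual yields one with encodings up to the next
  dual, and \<open>X\<close> itself is encoded by the identity.\<close>

definition bm_closed :: "('b, 'x) lc_bimodule \<Rightarrow> bool" where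
  "bm_closed X \<longleftrightarrow>
     (\<forall>x\<in>bm_carrier X. \<forall>y\<in>bm_carrier X. bm_add X x y \<in> bm_carrier X) \<and>
     (\<forall>c. \<forall>x\<in>bm_carrier X. bm_scale X c x \<in> bm_carrier X)"

definition lc_iso :: "('x \<Rightarrow> 'y) \<Rightarrow> ('b, 'x) lc_bimodule \<Rightarrow> ('b, 'y) lc_bimodule \<Rightarrow> bool" where
  "lc_iso h X Y \<longleftrightarrow>
     bm_closed X \<and> bij_betw h (bm_carrier X) (bm_carrier Y) \<and>
     (\<forall>x\<in>bm_carrier X. \<forall>y\<in>bm_carrier X. h (bm_add X x y) = bm_add Y (h x) (h y)) \<and>
     (\<forall>c. \<forall>x\<in>bm_carrier X. h (bm_scale X c x) = bm_scale Y c (h x)) \<and>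
     (\<forall>q\<in>bm_seminorms X. \<exists>q'\<in>bm_seminorms Y. \<forall>x\<in>bm_carrier X. q' (h x) = q x) \<and>
     (\<forall>q'\<in>bm_seminorms Y. \<exists>q\<in>bm_seminorms X. \<forall>x\<in>bm_carrier X. q' (h x) = q x)"

lemma lc_iso_rename:
  assumes "bm_closed X" "inj_on h (bm_carrier X)"
  shows "lc_iso h X (rename_bimodule h X)"
  using assms unfolding lc_iso_def rename_bimodule_def Let_def bm_closed_def
  by (auto simp: bij_betw_def the_inv_into_f_f)

lemma lc_iso_sym:
  assumes "lc_iso h X Y"
  shows "lc_iso (the_inv_into (bm_carrier X) h) Y X"
proof -
  let ?g = "the_inv_into (bm_carrier X) h"
  have bij: "bij_betw h (bm_carrier X) (bm_carrier Y)" and cl: "bm_closed X"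
    using assms by (auto simp: lc_iso_def)
  have inj: "inj_on h (bm_carrier X)" and im: "h ` bm_carrier X = bm_carrier Y"
    using bij by (auto simp: bij_betw_def)
  have gh [simp]: "?g (h x) = x" if "x \<in> bm_carrier X" for x
    using that inj by (simp add: the_inv_into_f_f)
  have add: "bm_add Y (h x) (h y) = h (bm_add X x y)" "bm_add X x y \<in> bm_carrier X"
    if "x \<in> bm_carrier X" "y \<in> bm_carrier X" for x y
    using assms that by (auto simp: lc_iso_def bm_closed_def)
  have sc: "bm_scale Y c (h x) = h (bm_scale X c x)" "bm_scale X c x \<in> bm_carrier X"
    if "x \<in> bm_carrier X" for c x
    using assms that by (auto simp: lc_iso_def bm_closed_def)
  show ?thesis
    unfolding lc_iso_def bm_closed_def
  proof (intro conjI)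
    show "bij_betw ?g (bm_carrier Y) (bm_carrier X)"
      using bij by (rule bij_betw_the_inv_into)
    show "\<forall>q\<in>bm_seminorms Y. \<exists>q'\<in>bm_seminorms X. \<forall>x\<in>bm_carrier Y. q' (?g x) = q x"
    proof
      fix q assume "q \<in> bm_seminorms Y"
      then obtain q' where "q' \<in> bm_seminorms X" "\<forall>x\<in>bm_carrier X. q (h x) = q' x"
        using assms unfolding lc_iso_def by blast
      then show "\<exists>q'\<in>bm_seminorms X. \<forall>x\<in>bm_carrier Y. q' (?g x) = q x"
        by (intro bexI [of _ q']) (auto simp: im [symmetric])
    qed
    show "\<forall>q'\<in>bm_seminorms X. \<exists>q\<in>bm_seminorms Y. \<forall>x\<in>bm_carrier Y. q' (?g x) = q x"
    proof
      fix q assume "q \<in> bm_seminorms X"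
      then obtain q' where "q' \<in> bm_seminorms Y" "\<forall>x\<in>bm_carrier X. q' (h x) = q x"
        using assms unfolding lc_iso_def by blast
      then show "\<exists>q'\<in>bm_seminorms Y. \<forall>x\<in>bm_carrier Y. q (?g x) = q' x"
        by (intro bexI [of _ q']) (auto simp: im [symmetric])
    qed
  qed (auto simp: im [symmetric] add sc)
qed

lemma lc_iso_continuous:
  assumes "lc_iso h X Y"
  shows "continuous_map (bm_topology X) (bm_topology Y) h"
proof -
  have diff: "h (bm_diff X x y) = bm_diff Y (h x) (h y)" "bm_diff X x y \<in> bm_carrier X"
    if "x \<in> bm_carrier X" "y \<in> bm_carrier X" for x y
    using assms that by (auto simp: lc_iso_def bm_diff_def bm_closed_def)
  have bij: "bij_betw h (bm_carrier X) (bm_carrier Y)"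
    using assms by (auto simp: lc_iso_def)
  have sub: "topspace (bm_topology X) \<subseteq> bm_carrier X"
    by (auto simp: bm_topology_def topology_generated_by_topspace)
  have opn: "openin (bm_topology X) {y \<in> bm_carrier X. q (bm_diff X y x) < r}"
    if "q \<in> bm_seminorms X" "x \<in> bm_carrier X" "0 < r" for q x r
    unfolding bm_topology_def
    by (rule topology_generated_by_Basis) (use that in blast)
  show ?thesis
    unfolding bm_topology_def [of Y] continuous_on_generated_topo_iff
  proof (intro conjI allI impI)
    fix U assume "U \<in> {{y \<in> bm_carrier Y. q (bm_diff Y y x) < r} |q x r.
        q \<in> bm_seminorms Y \<and> x \<in> bm_carrier Y \<and> 0 < r}"
    then obtain q x r where U: "U = {y \<in> bm_carrier Y. q (bm_diff Y y x) < r}"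
      and q: "q \<in> bm_seminorms Y" and x: "x \<in> bm_carrier Y" and r: "0 < r" by blast
    obtain x' where x': "x' \<in> bm_carrier X" "x = h x'"
      using bij x by (auto simp: bij_betw_def)
    obtain q' where q': "q' \<in> bm_seminorms X" "\<And>x. x \<in> bm_carrier X \<Longrightarrow> q (h x) = q' x"
      using assms q unfolding lc_iso_def by blast
    have "h -` U \<inter> topspace (bm_topology X)
        = {y \<in> bm_carrier X. q' (bm_diff X y x') < r} \<inter> topspace (bm_topology X)"
      using sub bij by (auto simp: U x' q'(2) diff(2) simp flip: diff(1) dest: bij_betwE)
    then show "openin (bm_topology X) (h -` U \<inter> topspace (bm_topology X))"
      using opn [OF q'(1) x'(1) r] by auto
  next
    show "h ` topspace (bm_topology X) \<subseteq> \<Union> {{y \<in> bm_carrier Y. q (bm_diff Y y x) < r} |q x r.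
        q \<in> bm_seminorms Y \<and> x \<in> bm_carrier Y \<and> 0 < r}"
    proof (rule image_subsetI)
      fix z assume "z \<in> topspace (bm_topology X)"
      then obtain q x r where z: "z \<in> bm_carrier X" "q (bm_diff X z x) < r"
        and q: "q \<in> bm_seminorms X" and x: "x \<in> bm_carrier X" and r: "0 < r"
        by (auto simp: bm_topology_def topology_generated_by_topspace)
      obtain q' where q': "q' \<in> bm_seminorms Y" "\<And>x. x \<in> bm_carrier X \<Longrightarrow> q' (h x) = q x"
        using assms q unfolding lc_iso_def by blast
      have "h z \<in> {y \<in> bm_carrier Y. q' (bm_diff Y y (h x)) < r}"
        using bij z x q'(2) by (auto simp flip: diff(1) simp: diff(2) dest: bij_betwE)
      moreover have "h x \<in> bm_carrier Y" using bij x by (auto dest: bij_betwE)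
      ultimately show "h z \<in> \<Union> {{y \<in> bm_carrier Y. q (bm_diff Y y x) < r} |q x r.
        q \<in> bm_seminorms Y \<and> x \<in> bm_carrier Y \<and> 0 < r}"
        using q' r by blast
    qed
  qed
qed

lemma bm_closed_strong_dual: "bm_closed X \<Longrightarrow> bm_closed (strong_dual X)"
proof -
  have sub: "topspace (bm_topology X) \<subseteq> bm_carrier X"
    by (auto simp: bm_topology_def topology_generated_by_topspace)
  assume cl: "bm_closed X"
  have 1: "continuous_map (bm_topology X) euclidean (\<lambda>x\<in>bm_carrier X. f x + g x)"
    if "continuous_map (bm_topology X) euclidean f" "continuous_map (bm_topology X) euclidean g"
    for f g :: "_ \<Rightarrow> complex"
    by (rule continuous_map_eq [OF continuous_map_add [OF that]]) (use sub in auto)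
  have 2: "continuous_map (bm_topology X) euclidean (\<lambda>x\<in>bm_carrier X. c * f x)"
    if "continuous_map (bm_topology X) euclidean f" for c and f :: "_ \<Rightarrow> complex"
  proof (rule continuous_map_eq)
    show "continuous_map (bm_topology X) euclidean ((\<lambda>z. c * z) \<circ> f)"
      by (rule continuous_map_compose [OF that]) (simp add: continuous_intros)
  qed (use sub in auto)
  show ?thesis
    using cl 1 2 unfolding bm_closed_def strong_dual_def continuous_functionals_def
    by (auto simp: algebra_simps)
qed

lemma lc_iso_pullback:
  assumes F: "F \<in> continuous_functionals W" and k: "lc_iso k V W"
  shows "(\<lambda>x\<in>bm_carrier V. F (k x)) \<in> continuous_functionals V"
proof -
  have "continuous_map (bm_topology V) euclidean (F \<circ> k)"
    using lc_iso_continuous [OF k] F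
    by (auto simp: continuous_functionals_def intro: continuous_map_compose)
  then have "continuous_map (bm_topology V) euclidean (\<lambda>x\<in>bm_carrier V. F (k x))"
    by (rule continuous_map_eq) (auto simp: bm_topology_def topology_generated_by_topspace)
  then show ?thesis
    using F k unfolding continuous_functionals_def lc_iso_def bm_closed_def
    by (auto dest: bij_betwE)
qed

lemma lc_iso_bounded:
  assumes S: "bm_bounded V S" and k: "lc_iso k V W"
  shows "bm_bounded W (k ` S)"
  unfolding bm_bounded_def
proof (intro conjI ballI)
  show "k ` S \<subseteq> bm_carrier W"
    using S k by (auto simp: bm_bounded_def lc_iso_def dest: bij_betwE)
  fix q assume "q \<in> bm_seminorms W"
  then obtain q' where q': "q' \<in> bm_seminorms V" "\<And>x. x \<in> bm_carrier V \<Longrightarrow> q (k x) = q' x"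
    using k unfolding lc_iso_def by blast
  have "q ` k ` S = q' ` S"
    using S q'(2) unfolding bm_bounded_def by (force simp: image_iff)
  then show "bdd_above (q ` k ` S)"
    using S q'(1) by (simp add: bm_bounded_def)
qed

lemma lc_iso_dual:
  assumes iso: "lc_iso h X Y"
  shows "lc_iso (\<lambda>F. \<lambda>x\<in>bm_carrier X. F (h x)) (strong_dual Y) (strong_dual X)"
proof -
  let ?g = "the_inv_into (bm_carrier X) h"
  let ?T = "\<lambda>F. \<lambda>x\<in>bm_carrier X. F (h x)" and ?R = "\<lambda>f. \<lambda>y\<in>bm_carrier Y. f (?g y)"
  have iso': "lc_iso ?g Y X" using iso by (rule lc_iso_sym)
  have bij: "bij_betw h (bm_carrier X) (bm_carrier Y)"
    using iso by (auto simp: lc_iso_def)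
  have inj: "inj_on h (bm_carrier X)" and im: "h ` bm_carrier X = bm_carrier Y"
    using bij by (auto simp: bij_betw_def)
  have gh [simp]: "?g (h x) = x" if "x \<in> bm_carrier X" for x
    using that inj by (simp add: the_inv_into_f_f)
  have hg [simp]: "h (?g y) = y" if "y \<in> bm_carrier Y" for y
    using that inj im by (auto simp: f_the_inv_into_f)
  have hin [simp]: "h x \<in> bm_carrier Y" if "x \<in> bm_carrier X" for x
    using that im by auto
  have gin [simp]: "?g y \<in> bm_carrier X" if "y \<in> bm_carrier Y" for y
    using that im the_inv_into_into [OF inj _ subset_refl] by auto
  show ?thesis
    unfolding lc_iso_def
  proof (intro conjI)
    show "bm_closed (strong_dual Y)"
      using iso' by (auto simp: lc_iso_def intro: bm_closed_strong_dual)
    show "bij_betw ?T (bm_carrier (strong_dual Y)) (bm_carrier (strong_dual X))"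
    proof (rule bij_betw_byWitness [where f' = ?R])
      show "\<forall>F\<in>bm_carrier (strong_dual Y). ?R (?T F) = F"
        by (auto simp: strong_dual_def continuous_functionals_def fun_eq_iff extensional_def)
      show "\<forall>f\<in>bm_carrier (strong_dual X). ?T (?R f) = f"
        by (auto simp: strong_dual_def continuous_functionals_def fun_eq_iff extensional_def)
    qed (auto simp: strong_dual_def intro: lc_iso_pullback iso iso')
    show "\<forall>F\<in>bm_carrier (strong_dual Y). \<forall>G\<in>bm_carrier (strong_dual Y).
        ?T (bm_add (strong_dual Y) F G) = bm_add (strong_dual X) (?T F) (?T G)"
      by (auto simp: strong_dual_def)
    show "\<forall>c. \<forall>F\<in>bm_carrier (strong_dual Y).
        ?T (bm_scale (strong_dual Y) c F) = bm_scale (strong_dual X) c (?T F)"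
      by (auto simp: strong_dual_def)
    show "\<forall>q\<in>bm_seminorms (strong_dual Y). \<exists>q'\<in>bm_seminorms (strong_dual X).
        \<forall>F\<in>bm_carrier (strong_dual Y). q' (?T F) = q F"
    proof
      fix q assume "q \<in> bm_seminorms (strong_dual Y)"
      then obtain S where q: "q = (\<lambda>F. SUP y\<in>S. cmod (F y))" and S: "S \<noteq> {}" "bm_bounded Y S"
        by (auto simp: strong_dual_def)
      have sub: "S \<subseteq> bm_carrier Y" using S by (simp add: bm_bounded_def)
      have "(SUP x\<in>?g ` S. cmod (?T F x)) = q F" for F
        unfolding q image_image using sub by (intro SUP_cong) auto
      moreover have "(\<lambda>f. SUP x\<in>?g ` S. cmod (f x)) \<in> bm_seminorms (strong_dual X)"
        using lc_iso_bounded [OF S(2) iso'] S(1) by (auto simp: strong_dual_def)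
      ultimately show "\<exists>q'\<in>bm_seminorms (strong_dual X).
          \<forall>F\<in>bm_carrier (strong_dual Y). q' (?T F) = q F"
        by (intro bexI [of _ "\<lambda>f. SUP x\<in>?g ` S. cmod (f x)"]) auto
    qed
    show "\<forall>q'\<in>bm_seminorms (strong_dual X). \<exists>q\<in>bm_seminorms (strong_dual Y).
        \<forall>F\<in>bm_carrier (strong_dual Y). q' (?T F) = q F"
    proof
      fix q assume "q \<in> bm_seminorms (strong_dual X)"
      then obtain S where q: "q = (\<lambda>F. SUP y\<in>S. cmod (F y))" and S: "S \<noteq> {}" "bm_bounded X S"
        by (auto simp: strong_dual_def)
      have sub: "S \<subseteq> bm_carrier X" using S by (simp add: bm_bounded_def)
      have "q (?T F) = (SUP y\<in>h ` S. cmod (F y))" for F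
        unfolding q image_image using sub by (intro SUP_cong) auto
      moreover have "(\<lambda>f. SUP y\<in>h ` S. cmod (f y)) \<in> bm_seminorms (strong_dual Y)"
        using lc_iso_bounded [OF S(2) iso] S(1) by (auto simp: strong_dual_def)
      ultimately show "\<exists>q'\<in>bm_seminorms (strong_dual Y).
          \<forall>F\<in>bm_carrier (strong_dual Y). q (?T F) = q' F"
        by (intro bexI [of _ "\<lambda>f. SUP y\<in>h ` S. cmod (f y)"]) auto
    qed
  qed
qed

lemma bm_carrier_strong_dual: "bm_carrier (strong_dual X) = continuous_functionals X"
  by (simp add: strong_dual_def)

lemma lc_iso_trans:
  assumes "lc_iso h X Y" "lc_iso k Y Z" "\<And>x. x \<in> bm_carrier X \<Longrightarrow> m x = k (h x)"
  shows "lc_iso m X Z"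
proof -
  have hin: "h x \<in> bm_carrier Y" if "x \<in> bm_carrier X" for x
    using assms(1) that by (auto simp: lc_iso_def dest: bij_betwE)
  have "bij_betw (k \<circ> h) (bm_carrier X) (bm_carrier Z)"
    using assms(1,2) by (auto simp: lc_iso_def intro: bij_betw_trans)
  then have "bij_betw m (bm_carrier X) (bm_carrier Z)"
    by (rule bij_betw_cong [THEN iffD1, rotated]) (simp add: assms(3))
  moreover have
    "\<forall>q\<in>bm_seminorms X. \<exists>q'\<in>bm_seminorms Z. \<forall>x\<in>bm_carrier X. q' (m x) = q x"
  proof
    fix q assume "q \<in> bm_seminorms X"
    then obtain q1 where q1: "q1 \<in> bm_seminorms Y" "\<forall>x\<in>bm_carrier X. q1 (h x) = q x"
      using assms(1) unfolding lc_iso_def by blast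
    then obtain q2 where "q2 \<in> bm_seminorms Z" "\<forall>y\<in>bm_carrier Y. q2 (k y) = q1 y"
      using assms(2) unfolding lc_iso_def by blast
    then show "\<exists>q'\<in>bm_seminorms Z. \<forall>x\<in>bm_carrier X. q' (m x) = q x"
      using q1 hin by (intro bexI [of _ q2]) (auto simp: assms(3))
  qed
  moreover have
    "\<forall>q'\<in>bm_seminorms Z. \<exists>q\<in>bm_seminorms X. \<forall>x\<in>bm_carrier X. q' (m x) = q x"
  proof
    fix q assume "q \<in> bm_seminorms Z"
    then obtain q1 where q1: "q1 \<in> bm_seminorms Y" "\<forall>y\<in>bm_carrier Y. q (k y) = q1 y"
      using assms(2) unfolding lc_iso_def by blast
    then obtain q2 where "q2 \<in> bm_seminorms X" "\<forall>x\<in>bm_carrier X. q1 (h x) = q2 x"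
      using assms(1) unfolding lc_iso_def by blast
    then show "\<exists>q'\<in>bm_seminorms X. \<forall>x\<in>bm_carrier X. q (m x) = q' x"
      using q1 hin by (intro bexI [of _ q2]) (auto simp: assms(3))
  qed
  ultimately show ?thesis
    using assms hin unfolding lc_iso_def bm_closed_def by simp
qed

lemma bm_closed_regular: "bm_closed (regular_bimodule p)"
  by (simp add: bm_closed_def regular_bimodule_def)

lemma encodes_duals_0: "encodes_duals id c X 0"
  by (simp add: encodes_duals_def)

lemma encodes_duals_Suc:
  fixes e :: "'x \<Rightarrow> 'u" and X :: "('b, 'x) lc_bimodule"
  assumes enc: "encodes_duals e c X n" and cl: "bm_closed X"
  shows "\<exists>(e' :: 'x \<Rightarrow> 'u + ('u \<Rightarrow> complex)) c'. encodes_duals e' c' X (Suc n)"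
proof -
  define e' :: "'x \<Rightarrow> 'u + ('u \<Rightarrow> complex)" where "e' = Inl \<circ> e"
  define res where "res k F = (\<lambda>x\<in>bm_carrier (iterated_dual e c X k). F (Inl x))"
    for k and F :: "'u + ('u \<Rightarrow> complex) \<Rightarrow> complex"
  define c' where "c' k F = (if k < n then Inl (c k (res k F)) else Inr (res k F))" for k F
  let ?I = "iterated_dual e c X" and ?J = "iterated_dual e' c' X"
  have inj_c': "inj_on (c' k) S" if "k < n" "inj_on (c k) T" "bij_betw (res k) S T" for k S T
  proof -
    have "inj_on (Inl \<circ> (c k \<circ> res k)) S"
      using that by (intro comp_inj_on) (auto simp: bij_betw_def)
    moreover have "c' k = Inl \<circ> (c k \<circ> res k)"
      using that by (simp add: c'_def fun_eq_iff)
    ultimately show ?thesis by simp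
  qed
  have inj_res: "inj_on (res k) (continuous_functionals (?J k))"
    and iso_res: "lc_iso (res k) (strong_dual (?J k)) (strong_dual (?I k))"
    if "lc_iso Inl (?I k) (?J k)" for k
  proof -
    show *: "lc_iso (res k) (strong_dual (?J k)) (strong_dual (?I k))"
      using lc_iso_dual [OF that] by (simp add: res_def [abs_def])
    then show "inj_on (res k) (continuous_functionals (?J k))"
      by (simp add: lc_iso_def bij_betw_def bm_carrier_strong_dual)
  qed
  have iso: "lc_iso Inl (?I k) (?J k)" if "k \<le> n" for k
    using that
  proof (induction k)
    case 0
    have "inj_on e (bm_carrier X)" using enc by (simp add: encodes_duals_def)
    then have 1: "lc_iso e X (?I 0)" and 2: "lc_iso e' X (?J 0)"
      using cl by (auto intro!: lc_iso_rename simp: e'_def inj_on_def)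
    have 3: "bm_carrier (?I 0) = e ` bm_carrier X"
      by (simp add: rename_bimodule_def Let_def)
    show ?case
      by (rule lc_iso_trans [OF lc_iso_sym [OF 1] 2])
        (use \<open>inj_on e (bm_carrier X)\<close> in \<open>auto simp: 3 e'_def the_inv_into_f_f simp del: iterated_dual.simps\<close>)
  next
    case (Suc k)
    let ?T = "the_inv_into (bm_carrier (strong_dual (?J k))) (res k)"
    from Suc have iso_k: "lc_iso Inl (?I k) (?J k)" and k: "k < n" by auto
    have inj: "inj_on (c k) (continuous_functionals (?I k))"
      using enc k by (simp add: encodes_duals_def)
    have iso1: "lc_iso ?T (strong_dual (?I k)) (strong_dual (?J k))"
      using iso_res [OF iso_k] by (rule lc_iso_sym)
    have bij: "bij_betw (res k) (continuous_functionals (?J k)) (continuous_functionals (?I k))"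
      using iso_res [OF iso_k] by (simp add: lc_iso_def bm_carrier_strong_dual)
    have "inj_on (c' k) (continuous_functionals (?J k))"
      using k inj bij by (rule inj_c')
    then have 2: "lc_iso (c' k) (strong_dual (?J k)) (?J (Suc k))"
      unfolding iterated_dual.simps
      by (intro lc_iso_rename) (use iso_res [OF iso_k] in \<open>auto simp: lc_iso_def bm_carrier_strong_dual\<close>)
    have 1: "lc_iso (c k) (strong_dual (?I k)) (?I (Suc k))"
      unfolding iterated_dual.simps
      by (intro lc_iso_rename) (use iso1 inj in \<open>auto simp: lc_iso_def bm_carrier_strong_dual\<close>)
    have 3: "lc_iso (\<lambda>f. c' k (?T f)) (strong_dual (?I k)) (?J (Suc k))"
      by (rule lc_iso_trans [OF iso1 2]) simp
    have T: "c' k (?T f) = Inl (c k f)" if "f \<in> continuous_functionals (?I k)" for f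
      using that bij k by (simp add: c'_def bij_betw_def f_the_inv_into_f bm_carrier_strong_dual)
    have C: "bm_carrier (?I (Suc k)) = c k ` continuous_functionals (?I k)"
      by (simp add: rename_bimodule_def strong_dual_def Let_def)
    show ?case
    proof (rule lc_iso_trans [OF lc_iso_sym [OF 1] 3])
      fix x assume "x \<in> bm_carrier (?I (Suc k))"
      then obtain f where "f \<in> continuous_functionals (?I k)" "x = c k f"
        unfolding C by blast
      moreover from this have "the_inv_into (bm_carrier (strong_dual (?I k))) (c k) x = f"
        using inj by (simp add: bm_carrier_strong_dual the_inv_into_f_f)
      ultimately show "Inl x = c' k (?T (the_inv_into (bm_carrier (strong_dual (?I k))) (c k) x))"
        using T by simp
    qed
  qed
  have "inj_on (c' k) (continuous_functionals (?J k))" if "k < Suc n" for k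
  proof (cases "k < n")
    case True
    have "inj_on (c k) (continuous_functionals (?I k))"
      using enc True by (simp add: encodes_duals_def)
    moreover have "bij_betw (res k) (continuous_functionals (?J k)) (continuous_functionals (?I k))"
      using iso_res [OF iso] True by (simp add: lc_iso_def bm_carrier_strong_dual)
    ultimately show ?thesis
      using True by (intro inj_c')
  next
    case False
    then have "c' k = Inr \<circ> res k" and "inj_on (res k) (continuous_functionals (?J k))"
      using inj_res [OF iso] that by (auto simp: c'_def fun_eq_iff)
    then show ?thesis
      by (simp add: comp_inj_on)
  qed
  moreover have "inj_on e' (bm_carrier X)"
    using enc by (auto simp: encodes_duals_def e'_def inj_on_def)
  ultimately show ?thesis
    unfolding encodes_duals_def by blast
qed


section \<open>Weak amenability\<close>

definition continuous_derivation ::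
    "(nat \<Rightarrow> 'b::complex_algebra \<Rightarrow> real) \<Rightarrow> ('b, 'x) lc_bimodule \<Rightarrow> ('b \<Rightarrow> 'x) \<Rightarrow> bool" where
  "continuous_derivation p X D \<longleftrightarrow>
     (\<forall>a. D a \<in> bm_carrier X) \<and>
     (\<forall>a b. D (a + b) = bm_add X (D a) (D b)) \<and>
     (\<forall>c a. D (scaleC c a) = bm_scale X c (D a)) \<and>
     continuous_map (bm_topology (regular_bimodule p)) (bm_topology X) D \<and>
     (\<forall>a b. D (a * b) = bm_add X (bm_left X a (D b)) (bm_right X (D a) b))"

definition inner_derivation :: "('b, 'x) lc_bimodule \<Rightarrow> ('b \<Rightarrow> 'x) \<Rightarrow> bool" where
  "inner_derivation X D \<longleftrightarrow>
     (\<exists>x\<in>bm_carrier X. \<forall>b. D b = bm_diff X (bm_left X b x) (bm_right X x b))"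

text \<open>Whether this holds does not depend on the encodings \<open>e\<close>, \<open>c\<close>, as long as
  \<^const>\<open>encodes_duals\<close> holds.\<close>

definition weakly_amenable ::
    "('b \<Rightarrow> 'u) \<Rightarrow> (nat \<Rightarrow> ('u \<Rightarrow> complex) \<Rightarrow> 'u) \<Rightarrow> nat
      \<Rightarrow> (nat \<Rightarrow> 'b::complex_algebra \<Rightarrow> real) \<Rightarrow> bool" where
  "weakly_amenable e c n p \<longleftrightarrow>
     (\<forall>D. continuous_derivation p (iterated_dual e c (regular_bimodule p) n) D \<longrightarrow>
        inner_derivation (iterated_dual e c (regular_bimodule p) n) D)"

end

theory Submission
  imports Defs
begin

text \<open>Write \<open>X\<close> and \<open>Y\<close> for the \<open>k\<close>-th duals of \<open>A\<close> and of its unitization.  As a locally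
  convex space \<open>Y\<close> is the direct sum of \<open>X\<close> and the scalars; the actions are
  \<open>a \<cdot> (x, \<mu>) = (a \<cdot> x + \<mu> i a, 0)\<close> for even \<open>k\<close>, with \<open>i\<close> the canonical map \<open>A \<rightarrow> X\<close>, and
  \<open>a \<cdot> (x, \<mu>) = (a \<cdot> x, j a x)\<close> for odd \<open>k\<close>, with \<open>j a\<close> the evaluation at \<open>i a\<close>.
  Let \<open>k\<close> be odd.  A derivation into \<open>Y\<close> vanishes at the identity, so it is a pair \<open>(D, d)\<close> of a
  derivation \<open>D : A \<rightarrow> X\<close> and a functional \<open>d\<close> on \<open>A\<close> with \<open>d (a b) = j a (D b) + j b (D a)\<close>.
  If \<open>D = ad x\<close>, this forces \<open>d (a b) = 0\<close>, hence \<open>d = 0\<close> since products are dense.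
  Conversely, every \<open>D\<close> has such a \<open>d\<close>, the limit of \<open>j u\<^sub>i (D a)\<close> along the bounded
  approximate identity \<open>u\<close>: it exists on products by the derivation rule, and everywhere by
  equicontinuity.\<close>

section \<open>Continuous linear maps and seminorm estimates\<close>

text \<open>The record has no field for zero, so zero is obtained as \<open>0\<close> times an
  arbitrary element; by \<open>scale_0\<close> the choice does not matter.\<close>

definition bm_zero :: "('b, 'x) lc_bimodule \<Rightarrow> 'x" where
  "bm_zero X = bm_scale X 0 (SOME x. x \<in> bm_carrier X)"

text \<open>The vector space laws are relative to the carrier, with zeros written as
  \<open>bm_scale X 0 y\<close> and negatives as \<open>bm_scale X (-1) y\<close>. A nonempty family
  of seminorms ensures that the balls generating \<open>bm_topology\<close> cover the
  carrier.\<close>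

locale lc_space =
  fixes X :: "('b, 'x) lc_bimodule"
  assumes add_closed [simp]:
      "\<lbrakk>x \<in> bm_carrier X; y \<in> bm_carrier X\<rbrakk> \<Longrightarrow> bm_add X x y \<in> bm_carrier X"
    and scale_closed [simp]: "x \<in> bm_carrier X \<Longrightarrow> bm_scale X a x \<in> bm_carrier X"
    and add_assoc: "\<lbrakk>x \<in> bm_carrier X; y \<in> bm_carrier X; z \<in> bm_carrier X\<rbrakk>
      \<Longrightarrow> bm_add X (bm_add X x y) z = bm_add X x (bm_add X y z)"
    and add_commute: "\<lbrakk>x \<in> bm_carrier X; y \<in> bm_carrier X\<rbrakk> \<Longrightarrow> bm_add X x y = bm_add X y x"
    and add_scale_0: "\<lbrakk>x \<in> bm_carrier X; y \<in> bm_carrier X\<rbrakk> \<Longrightarrow> bm_add X x (bm_scale X 0 y) = x"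
    and scale_add: "\<lbrakk>x \<in> bm_carrier X; y \<in> bm_carrier X\<rbrakk>
      \<Longrightarrow> bm_scale X a (bm_add X x y) = bm_add X (bm_scale X a x) (bm_scale X a y)"
    and add_scale: "x \<in> bm_carrier X
      \<Longrightarrow> bm_scale X (a + b) x = bm_add X (bm_scale X a x) (bm_scale X b x)"
    and scale_scale: "x \<in> bm_carrier X \<Longrightarrow> bm_scale X a (bm_scale X b x) = bm_scale X (a * b) x"
    and scale_one: "x \<in> bm_carrier X \<Longrightarrow> bm_scale X 1 x = x"
    and seminorm_add: "\<lbrakk>q \<in> bm_seminorms X; x \<in> bm_carrier X; y \<in> bm_carrier X\<rbrakk>
      \<Longrightarrow> q (bm_add X x y) \<le> q x + q y"
    and seminorm_scale: "\<lbrakk>q \<in> bm_seminorms X; x \<in> bm_carrier X\<rbrakk>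
      \<Longrightarrow> q (bm_scale X a x) = cmod a * q x"
    and carrier_nonempty: "bm_carrier X \<noteq> {}"
    and seminorms_nonempty: "bm_seminorms X \<noteq> {}"
begin

lemma scale_0:
  assumes x: "x \<in> bm_carrier X"
  shows "bm_scale X 0 x = bm_zero X"
proof -
  define y where "y = (SOME x. x \<in> bm_carrier X)"
  have y: "y \<in> bm_carrier X"
    unfolding y_def using carrier_nonempty by (simp add: some_in_eq)
  have "bm_scale X 0 x = bm_add X (bm_scale X 0 x) (bm_scale X 0 y)"
    using x y by (simp add: add_scale_0)
  also have "\<dots> = bm_add X (bm_scale X 0 y) (bm_scale X 0 x)"
    using x y by (intro add_commute) auto
  also have "\<dots> = bm_scale X 0 y"
    using x y by (simp add: add_scale_0)
  finally show ?thesis by (simp add: bm_zero_def y_def)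
qed

lemma zero_closed [simp]: "bm_zero X \<in> bm_carrier X"
proof -
  obtain x where "x \<in> bm_carrier X" using carrier_nonempty by blast
  then show ?thesis using scale_closed [of x 0] by (simp add: scale_0)
qed

lemma add_zero [simp]: "x \<in> bm_carrier X \<Longrightarrow> bm_add X x (bm_zero X) = x"
  using add_scale_0 [of x x] by (simp add: scale_0)

lemma zero_add [simp]: "x \<in> bm_carrier X \<Longrightarrow> bm_add X (bm_zero X) x = x"
  using add_commute [of x "bm_zero X"] by simp

lemma scale_zero [simp]: "bm_scale X a (bm_zero X) = bm_zero X"
  using scale_scale [of "bm_zero X" a 0] by (simp add: scale_0)

lemma add_left_commute: "\<lbrakk>x \<in> bm_carrier X; y \<in> bm_carrier X; z \<in> bm_carrier X\<rbrakk>
    \<Longrightarrow> bm_add X x (bm_add X y z) = bm_add X y (bm_add X x z)"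
  by (metis add_assoc add_commute)

lemma diff_closed [simp]:
  "\<lbrakk>x \<in> bm_carrier X; y \<in> bm_carrier X\<rbrakk> \<Longrightarrow> bm_diff X x y \<in> bm_carrier X"
  by (simp add: bm_diff_def)

lemma diff_self: "x \<in> bm_carrier X \<Longrightarrow> bm_diff X x x = bm_zero X"
  using add_scale [of x 1 "-1"] by (simp add: bm_diff_def scale_one scale_0)

lemma diff_zero [simp]: "x \<in> bm_carrier X \<Longrightarrow> bm_diff X x (bm_zero X) = x"
  by (simp add: bm_diff_def)

lemma diff_add_diff:
  assumes "x \<in> bm_carrier X" "y \<in> bm_carrier X" "z \<in> bm_carrier X"
  shows "bm_add X (bm_diff X x y) (bm_diff X y z) = bm_diff X x z"
proof -
  have "bm_add X (bm_diff X x y) (bm_diff X y z)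
      = bm_add X x (bm_add X (bm_diff X y y) (bm_scale X (-1) z))"
    using assms by (simp add: bm_diff_def add_assoc add_commute [of "bm_scale X (-1) y"])
  then show ?thesis
    using assms by (simp add: diff_self) (simp add: bm_diff_def)
qed

text \<open>Applied to a derivation at the identity \<open>e\<close>, where the product rule for
  \<open>e * e = e\<close> makes the value equal to its own double.\<close>

lemma add_self_eq_zero:
  assumes "x \<in> bm_carrier X" "bm_add X x x = x"
  shows "x = bm_zero X"
proof -
  have "bm_add X (bm_add X x x) (bm_scale X (-1) x) = bm_zero X"
    using assms diff_self by (simp add: bm_diff_def)
  then show ?thesis
    using assms(1) diff_self by (simp add: add_assoc bm_diff_def)
qed

text \<open>In a commutator over the unitization both actions add the same scalar multiple; this
  cancels it.\<close>

lemma diff_add_same: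
  assumes "x \<in> bm_carrier X" "y \<in> bm_carrier X" "z \<in> bm_carrier X"
  shows "bm_diff X (bm_add X x z) (bm_add X y z) = bm_diff X x y"
proof -
  have "bm_diff X (bm_add X x z) (bm_add X y z)
      = bm_add X x (bm_add X (bm_diff X z z) (bm_scale X (-1) y))"
    using assms by (simp add: bm_diff_def add_assoc scale_add add_commute [of "bm_scale X (-1) y"])
  then show ?thesis
    using assms by (simp add: diff_self) (simp add: bm_diff_def)
qed

lemma seminorm_zero [simp]: "q \<in> bm_seminorms X \<Longrightarrow> q (bm_zero X) = 0"
  using seminorm_scale [of q "bm_zero X" 0] by simp

text \<open>Zero is \<open>q\<close> at \<open>x - x\<close>, which subadditivity bounds by twice
  \<open>q x\<close>.\<close>

lemma seminorm_nonneg: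
  assumes "q \<in> bm_seminorms X" "x \<in> bm_carrier X"
  shows "0 \<le> q x"
proof -
  have "q (bm_diff X x x) \<le> q x + q x"
    using assms seminorm_add [of q x "bm_scale X (-1) x"]
    by (simp add: bm_diff_def seminorm_scale)
  then show ?thesis using assms by (simp add: diff_self)
qed

section \<open>Neighbourhoods in the topology of the seminorms\<close>

lemma openin_ball:
  assumes "q \<in> bm_seminorms X" "x \<in> bm_carrier X" "0 < r"
  shows "openin (bm_topology X) {y \<in> bm_carrier X. q (bm_diff X y x) < r}"
  unfolding bm_topology_def
  by (rule topology_generated_by_Basis) (use assms in blast)

text \<open>The topology is generated by balls with all centres. The triangle inequality recentres
  them, so finite intersections of balls about a point form a neighbourhood base there.\<close>

lemma openin_iff:
  "openin (bm_topology X) U \<longleftrightarrow> U \<subseteq> bm_carrier X \<and>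
     (\<forall>x\<in>U. \<exists>F d. finite F \<and> F \<subseteq> bm_seminorms X \<and> 0 < d \<and>
        (\<forall>y\<in>bm_carrier X. (\<forall>q\<in>F. q (bm_diff X y x) < d) \<longrightarrow> y \<in> U))"
proof -
  define N where "N x U \<longleftrightarrow> (\<exists>F d. finite F \<and> F \<subseteq> bm_seminorms X \<and> 0 < d \<and>
        (\<forall>y\<in>bm_carrier X. (\<forall>q\<in>F. q (bm_diff X y x) < d) \<longrightarrow> y \<in> U))" for x U
  have NE: thesis if "N x U" "\<And>F d. \<lbrakk>finite F; F \<subseteq> bm_seminorms X; 0 < d;
      \<forall>y\<in>bm_carrier X. (\<forall>q\<in>F. q (bm_diff X y x) < d) \<longrightarrow> y \<in> U\<rbrakk> \<Longrightarrow> thesis"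
    for x U thesis
    using that unfolding N_def by blast
  have NI: "N x U" if "finite F" "F \<subseteq> bm_seminorms X" "0 < d"
      "\<forall>y\<in>bm_carrier X. (\<forall>q\<in>F. q (bm_diff X y x) < d) \<longrightarrow> y \<in> U" for x U F d
    using that unfolding N_def by blast
  have "U \<subseteq> bm_carrier X \<and> (\<forall>x\<in>U. N x U)" if "openin (bm_topology X) U"
  proof -
    have "generate_topology_on {{y \<in> bm_carrier X. q (bm_diff X y x) < r} | q x r.
        q \<in> bm_seminorms X \<and> x \<in> bm_carrier X \<and> 0 < r} U"
      using that by (simp add: bm_topology_def openin_topology_generated_by_iff)
    then show ?thesis
    proof (induction rule: generate_topology_on.induct)
      case (Int V W)
      have "N x (V \<inter> W)" if x: "x \<in> V" "x \<in> W" for x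
      proof -
        have N: "N x V" "N x W" using Int.IH x by auto
        obtain F d where F: "finite F" "F \<subseteq> bm_seminorms X" "0 < d"
            "\<forall>y\<in>bm_carrier X. (\<forall>q\<in>F. q (bm_diff X y x) < d) \<longrightarrow> y \<in> V"
          by (rule NE [OF N(1)])
        obtain F' d' where F': "finite F'" "F' \<subseteq> bm_seminorms X" "0 < d'"
            "\<forall>y\<in>bm_carrier X. (\<forall>q\<in>F'. q (bm_diff X y x) < d') \<longrightarrow> y \<in> W"
          by (rule NE [OF N(2)])
        show ?thesis
          by (rule NI [of "F \<union> F'" "min d d'"]) (use F F' in auto)
      qed
      then show ?case using Int.IH by auto
    next
      case (UN K)
      have "N x (\<Union>K)" if "x \<in> V" "V \<in> K" for x V
      proof -
        have "N x V" using UN.IH that by auto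
        then obtain F d where F: "finite F" "F \<subseteq> bm_seminorms X" "0 < d"
            "\<forall>y\<in>bm_carrier X. (\<forall>q\<in>F. q (bm_diff X y x) < d) \<longrightarrow> y \<in> V"
          by (elim NE)
        show ?thesis
          by (rule NI [OF F(1-3)]) (use F(4) that in blast)
      qed
      then show ?case using UN.IH by auto
    next
      case (Basis s)
      then obtain q z r where s: "s = {y \<in> bm_carrier X. q (bm_diff X y z) < r}"
        and q: "q \<in> bm_seminorms X" and z: "z \<in> bm_carrier X" by blast
      \<comment> \<open>The ball about \<open>z\<close> contains a ball about \<open>x\<close> whose
        radius is what remains of \<open>r\<close>.\<close>
      have "N x s" if x: "x \<in> s" for x
      proof (rule NI [of "{q}" "r - q (bm_diff X x z)"], goal_cases)
        case 4
        show ?case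
        proof (intro ballI impI)
          fix y assume y: "y \<in> bm_carrier X" "\<forall>q'\<in>{q}. q' (bm_diff X y x) < r - q (bm_diff X x z)"
          have "q (bm_diff X y z) \<le> q (bm_diff X y x) + q (bm_diff X x z)"
            using seminorm_add [OF q, of "bm_diff X y x" "bm_diff X x z"] x y z
            by (simp add: diff_add_diff s)
          then show "y \<in> s" using y by (simp add: s)
        qed
      qed (use x q in \<open>auto simp: s\<close>)
      then show ?case by (auto simp: s)
    qed auto
  qed
  moreover have "openin (bm_topology X) U" if U: "U \<subseteq> bm_carrier X" "\<forall>x\<in>U. N x U"
  proof (subst openin_subopen, intro ballI)
    have top: "bm_carrier X \<subseteq> topspace (bm_topology X)"
    proof
      fix x assume x: "x \<in> bm_carrier X"
      obtain q where q: "q \<in> bm_seminorms X" using seminorms_nonempty by blast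
      have "x \<in> {y \<in> bm_carrier X. q (bm_diff X y x) < 1}"
        using x q by (simp add: diff_self)
      then show "x \<in> topspace (bm_topology X)"
        using openin_subset [OF openin_ball [OF q x zero_less_one]] by blast
    qed
    fix x assume x: "x \<in> U"
    then have xc: "x \<in> bm_carrier X" and "N x U" using U by auto
    then obtain F d where F: "finite F" "F \<subseteq> bm_seminorms X" "0 < d"
        "\<forall>y\<in>bm_carrier X. (\<forall>q\<in>F. q (bm_diff X y x) < d) \<longrightarrow> y \<in> U"
      by (elim NE)
    \<comment> \<open>For empty \<open>F\<close> the bare intersection would be the whole type;
      intersecting with the space keeps \<open>T\<close> open and inside the carrier.\<close>
    define T where "T = (\<Inter>q\<in>F. {y \<in> bm_carrier X. q (bm_diff X y x) < d})
      \<inter> topspace (bm_topology X)"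
    have "openin (bm_topology X) T"
      unfolding T_def using F xc by (intro openin_INT openin_ball) auto
    moreover have "x \<in> T"
      using top xc F by (auto simp: T_def diff_self subset_iff)
    moreover have "T \<subseteq> U"
    proof
      fix y assume y: "y \<in> T"
      then have "y \<in> bm_carrier X"
        by (auto simp: T_def bm_topology_def topology_generated_by_topspace)
      then show "y \<in> U" using F(4) y by (auto simp: T_def)
    qed
    ultimately show "\<exists>T. openin (bm_topology X) T \<and> x \<in> T \<and> T \<subseteq> U" by blast
  qed
  ultimately show ?thesis unfolding N_def by blast
qed

lemma topspace_eq [simp]: "topspace (bm_topology X) = bm_carrier X"
proof
  show "topspace (bm_topology X) \<subseteq> bm_carrier X"
    by (auto simp: bm_topology_def topology_generated_by_topspace)
  have "openin (bm_topology X) (bm_carrier X)"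
    unfolding openin_iff by (auto intro!: exI [of _ "{}"] exI [of _ 1])
  then show "bm_carrier X \<subseteq> topspace (bm_topology X)"
    by (rule openin_subset)
qed

end

section \<open>Domination by finitely many seminorms\<close>

definition dominated :: "('b, 'x) lc_bimodule \<Rightarrow> ('x \<Rightarrow> real) \<Rightarrow> bool" where
  "dominated X g \<longleftrightarrow> (\<exists>F C. finite F \<and> F \<subseteq> bm_seminorms X \<and> 0 \<le> C \<and>
     (\<forall>x\<in>bm_carrier X. g x \<le> C * (\<Sum>q\<in>F. q x)))"

lemma dominated_le:
  "\<lbrakk>dominated X g; \<And>x. x \<in> bm_carrier X \<Longrightarrow> f x \<le> g x\<rbrakk> \<Longrightarrow> dominated X f"
  unfolding dominated_def by (meson order_trans)

lemma dominated_zero: "dominated X (\<lambda>_. 0)"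
  unfolding dominated_def by (intro exI [of _ "{}"] exI [of _ 0]) simp

lemma dominated_seminorm: "q \<in> bm_seminorms X \<Longrightarrow> dominated X q"
  unfolding dominated_def by (intro exI [of _ "{q}"] exI [of _ 1]) simp

lemma dominated_cmult:
  assumes "dominated X g" "0 \<le> a"
  shows "dominated X (\<lambda>x. a * g x)"
proof -
  obtain F C where "finite F" "F \<subseteq> bm_seminorms X" "0 \<le> C"
    "\<forall>x\<in>bm_carrier X. g x \<le> C * (\<Sum>q\<in>F. q x)"
    using assms unfolding dominated_def by blast
  then show ?thesis
    unfolding dominated_def using assms
    by (intro exI [of _ F] exI [of _ "a * C"]) (auto simp: mult.assoc intro: mult_left_mono)
qed

lemma dominated_bounded:
  assumes "dominated X g" "bm_bounded X B"
  shows "bdd_above (g ` B)"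
proof -
  obtain F C where F: "finite F" "F \<subseteq> bm_seminorms X" "0 \<le> C"
    "\<forall>x\<in>bm_carrier X. g x \<le> C * (\<Sum>q\<in>F. q x)"
    using assms unfolding dominated_def by blast
  have "\<forall>q\<in>F. \<exists>M. \<forall>x\<in>B. q x \<le> M"
    using assms(2) F(2) by (auto simp: bm_bounded_def bdd_above_def subset_iff)
  then obtain M where M: "\<And>q x. \<lbrakk>q \<in> F; x \<in> B\<rbrakk> \<Longrightarrow> q x \<le> M q" by metis
  have "g x \<le> C * (\<Sum>q\<in>F. M q)" if "x \<in> B" for x
  proof -
    have "g x \<le> C * (\<Sum>q\<in>F. q x)" using F(4) that assms(2) by (auto simp: bm_bounded_def)
    also have "\<dots> \<le> C * (\<Sum>q\<in>F. M q)"
      using F(3) M that by (intro mult_left_mono sum_mono) auto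
    finally show ?thesis .
  qed
  then show ?thesis by (auto simp: bdd_above_def)
qed

context lc_space
begin

text \<open>For a seminorm, domination means continuity; as the generating family need not be
  directed, a finite sum of seminorms takes the place of a single one. Here both sums are enlarged
  to \<open>F \<union> G\<close> by nonnegativity.\<close>

lemma dominated_add:
  assumes "dominated X f" "dominated X g"
  shows "dominated X (\<lambda>x. f x + g x)"
proof -
  obtain F C where F: "finite F" "F \<subseteq> bm_seminorms X" "0 \<le> C"
    "\<forall>x\<in>bm_carrier X. f x \<le> C * (\<Sum>q\<in>F. q x)"
    using assms unfolding dominated_def by blast
  obtain G K where G: "finite G" "G \<subseteq> bm_seminorms X" "0 \<le> K"
    "\<forall>x\<in>bm_carrier X. g x \<le> K * (\<Sum>q\<in>G. q x)"
    using assms unfolding dominated_def by blast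
  have "f x + g x \<le> (C + K) * (\<Sum>q\<in>F \<union> G. q x)" if x: "x \<in> bm_carrier X" for x
  proof -
    have "(\<Sum>q\<in>F. q x) \<le> (\<Sum>q\<in>F \<union> G. q x)" "(\<Sum>q\<in>G. q x) \<le> (\<Sum>q\<in>F \<union> G. q x)"
      using F G x seminorm_nonneg by (auto intro!: sum_mono2)
    then have "C * (\<Sum>q\<in>F. q x) \<le> C * (\<Sum>q\<in>F \<union> G. q x)"
      "K * (\<Sum>q\<in>G. q x) \<le> K * (\<Sum>q\<in>F \<union> G. q x)"
      using F G by (auto intro: mult_left_mono)
    then show ?thesis using F(4) G(4) x by (fastforce simp: distrib_right)
  qed
  then show ?thesis
    unfolding dominated_def using F G by (intro exI [of _ "F \<union> G"] exI [of _ "C + K"]) auto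
qed

lemma dominated_sum:
  assumes "finite I" "\<And>i. i \<in> I \<Longrightarrow> dominated X (f i)"
  shows "dominated X (\<lambda>x. \<Sum>i\<in>I. f i x)"
  using assms by (induction I rule: finite_induct) (auto intro: dominated_zero dominated_add)

end

section \<open>Continuous linear maps\<close>

definition bm_linear :: "('b, 'x) lc_bimodule \<Rightarrow> ('d, 'y) lc_bimodule \<Rightarrow> ('x \<Rightarrow> 'y) \<Rightarrow> bool" where
  "bm_linear X Y T \<longleftrightarrow> (\<forall>x\<in>bm_carrier X. T x \<in> bm_carrier Y) \<and>
     (\<forall>x\<in>bm_carrier X. \<forall>y\<in>bm_carrier X. T (bm_add X x y) = bm_add Y (T x) (T y)) \<and>
     (\<forall>a. \<forall>x\<in>bm_carrier X. T (bm_scale X a x) = bm_scale Y a (T x))"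

text \<open>Continuity is an estimate, the form that transposes to duals;
  \<open>cont_linear_iff\<close> gives back the topological notion. The acting algebras may differ,
  so maps between a dual of the algebra and a dual of its unitization are covered.\<close>

definition cont_linear :: "('b, 'x) lc_bimodule \<Rightarrow> ('d, 'y) lc_bimodule \<Rightarrow> ('x \<Rightarrow> 'y) \<Rightarrow> bool" where
  "cont_linear X Y T \<longleftrightarrow> bm_linear X Y T \<and> (\<forall>q\<in>bm_seminorms Y. dominated X (\<lambda>x. q (T x)))"

lemma bm_linear_closed: "\<lbrakk>bm_linear X Y T; x \<in> bm_carrier X\<rbrakk> \<Longrightarrow> T x \<in> bm_carrier Y"
  by (simp add: bm_linear_def)

lemma bm_linear_add: "\<lbrakk>bm_linear X Y T; x \<in> bm_carrier X; y \<in> bm_carrier X\<rbrakk>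
    \<Longrightarrow> T (bm_add X x y) = bm_add Y (T x) (T y)"
  by (simp add: bm_linear_def)

lemma bm_linear_scale: "\<lbrakk>bm_linear X Y T; x \<in> bm_carrier X\<rbrakk>
    \<Longrightarrow> T (bm_scale X a x) = bm_scale Y a (T x)"
  by (simp add: bm_linear_def)

lemma bm_linear_zero:
  assumes "lc_space X" "lc_space Y" "bm_linear X Y T"
  shows "T (bm_zero X) = bm_zero Y"
  using bm_linear_scale [OF assms(3), of "bm_zero X" 0] lc_space.scale_zero [OF assms(1)]
    lc_space.zero_closed [OF assms(1)] lc_space.scale_0 [OF assms(2)]
    bm_linear_closed [OF assms(3)] by metis

lemma bm_linear_diff:
  assumes "lc_space X" "bm_linear X Y T" "x \<in> bm_carrier X" "y \<in> bm_carrier X"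
  shows "T (bm_diff X x y) = bm_diff Y (T x) (T y)"
  using assms lc_space.scale_closed [OF assms(1)]
  by (simp add: bm_diff_def bm_linear_def)

lemma cont_linear_linear: "cont_linear X Y T \<Longrightarrow> bm_linear X Y T"
  by (simp add: cont_linear_def)

lemma cont_linear_dominated:
  assumes "lc_space X" "cont_linear X Y T" "dominated Y g"
  shows "dominated X (\<lambda>x. g (T x))"
proof -
  obtain F C where F: "finite F" "F \<subseteq> bm_seminorms Y" "0 \<le> C"
    "\<forall>y\<in>bm_carrier Y. g y \<le> C * (\<Sum>q\<in>F. q y)"
    using assms unfolding dominated_def by blast
  have "dominated X (\<lambda>x. C * (\<Sum>q\<in>F. q (T x)))"
    using F assms(2)
    by (intro dominated_cmult lc_space.dominated_sum [OF assms(1)]) (auto simp: cont_linear_def)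
  then show ?thesis
    using assms(2) F(4) by (elim dominated_le) (auto simp: cont_linear_def bm_linear_def)
qed

lemma cont_linear_compose:
  assumes "lc_space X" "cont_linear X Y T" "cont_linear Y Z V"
  shows "cont_linear X Z (\<lambda>x. V (T x))"
  unfolding cont_linear_def
proof (intro conjI ballI)
  show "bm_linear X Z (\<lambda>x. V (T x))"
    using assms by (auto simp: cont_linear_def bm_linear_def)
  show "dominated X (\<lambda>x. q (V (T x)))" if "q \<in> bm_seminorms Z" for q
    using assms(3) that by (intro cont_linear_dominated [OF assms(1,2)]) (simp add: cont_linear_def)
qed

lemma cont_linear_bounded:
  assumes "cont_linear X Y T" "bm_bounded X B"
  shows "bm_bounded Y (T ` B)"
  using assms dominated_bounded [OF _ assms(2)]
  by (auto simp: bm_bounded_def cont_linear_def bm_linear_def image_image)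

text \<open>Continuity at zero puts a set where finitely many seminorms are small into the preimage
  of the unit ball of \<open>q\<close>; homogeneity turns this into a linear bound. Conversely, a
  linear bound applied to differences gives continuity at every point.\<close>

lemma cont_linear_iff:
  assumes X: "lc_space X" and Y: "lc_space Y"
  shows "cont_linear X Y T \<longleftrightarrow>
    bm_linear X Y T \<and> continuous_map (bm_topology X) (bm_topology Y) T"
proof (cases "bm_linear X Y T")
  case lin: True
  interpret X: lc_space X by (rule X)
  interpret Y: lc_space Y by (rule Y)
  note diff = bm_linear_diff [OF X lin]
  note closed = bm_linear_closed [OF lin]
  have "continuous_map (bm_topology X) (bm_topology Y) T \<longleftrightarrow>
      (\<forall>q\<in>bm_seminorms Y. dominated X (\<lambda>x. q (T x)))"
  proof
    assume cont: "continuous_map (bm_topology X) (bm_topology Y) T"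
    show "\<forall>q\<in>bm_seminorms Y. dominated X (\<lambda>x. q (T x))"
    proof
      fix q assume q: "q \<in> bm_seminorms Y"
      define V where "V = {y \<in> bm_carrier Y. q (bm_diff Y y (bm_zero Y)) < 1}"
      have "openin (bm_topology X) {x \<in> topspace (bm_topology X). T x \<in> V}"
        unfolding V_def using q
        by (intro openin_continuous_map_preimage [OF cont] Y.openin_ball) auto
      moreover have "bm_zero X \<in> {x \<in> topspace (bm_topology X). T x \<in> V}"
        using q bm_linear_zero [OF X Y lin] by (simp add: V_def)
      ultimately have "\<exists>F d. finite F \<and> F \<subseteq> bm_seminorms X \<and> 0 < d \<and> (\<forall>y\<in>bm_carrier X.
          (\<forall>r\<in>F. r (bm_diff X y (bm_zero X)) < d) \<longrightarrow> y \<in> {x \<in> topspace (bm_topology X). T x \<in> V})"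
        unfolding X.openin_iff by (elim conjE bspec)
      then obtain F d where F: "finite F" "F \<subseteq> bm_seminorms X" "0 < d"
          "\<forall>y\<in>bm_carrier X. (\<forall>r\<in>F. r (bm_diff X y (bm_zero X)) < d) \<longrightarrow> T y \<in> V"
        by auto
      \<comment> \<open>By nonnegativity each seminorm in \<open>F\<close> is at most their sum, so
        smallness of the sum suffices.\<close>
      have small: "q (T x) < 1" if "x \<in> bm_carrier X" and less: "(\<Sum>r\<in>F. r x) < d" for x
      proof -
        have "r x < d" if "r \<in> F" for r
        proof -
          have "r x \<le> (\<Sum>r\<in>F. r x)"
            using F \<open>x \<in> _\<close> that X.seminorm_nonneg by (intro member_le_sum) auto
          then show ?thesis using less by simp
        qed
        then show ?thesis using F(4) that(1) closed by (auto simp: V_def)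
      qed
      have "q (T x) \<le> inverse d * (\<Sum>r\<in>F. r x)" if x: "x \<in> bm_carrier X" for x
      \<comment> \<open>Comparing with every \<open>t\<close> above the bound keeps \<open>t\<close>
        positive even when the sum is zero, so that \<open>x\<close> can be divided by
        \<open>t\<close>.\<close>
      proof (rule dense_ge)
        fix t assume t: "inverse d * (\<Sum>r\<in>F. r x) < t"
        have "0 \<le> (\<Sum>r\<in>F. r x)" using F x X.seminorm_nonneg by (intro sum_nonneg) auto
        then have t0: "0 < t" using t F(3)
          by (intro le_less_trans [OF _ t]) simp
        let ?x = "bm_scale X (of_real (1 / t)) x"
        have "(\<Sum>r\<in>F. r ?x) = (\<Sum>r\<in>F. r x) / t"
          using F x t0 by (simp add: X.seminorm_scale subset_iff sum_divide_distrib norm_divide)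
        also have "\<dots> < d" using t t0 F(3) by (simp add: field_simps)
        finally have "q (T ?x) < 1" using x by (intro small) auto
        moreover have "q (T ?x) = q (T x) / t"
          using bm_linear_scale [OF lin x] q closed [OF x] t0
          by (simp add: Y.seminorm_scale norm_divide)
        ultimately show "q (T x) \<le> t" using t0 by (simp add: less_imp_le)
      qed
      then show "dominated X (\<lambda>x. q (T x))"
        unfolding dominated_def using F by (intro exI [of _ F] exI [of _ "inverse d"]) auto
    qed
  next
    assume dom: "\<forall>q\<in>bm_seminorms Y. dominated X (\<lambda>x. q (T x))"
    show "continuous_map (bm_topology X) (bm_topology Y) T"
      unfolding bm_topology_def [of Y] continuous_on_generated_topo_iff
    proof (intro conjI allI impI)
      show "T ` topspace (bm_topology X) \<subseteq> \<Union> {{y \<in> bm_carrier Y. q (bm_diff Y y x) < r} |q x r.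
          q \<in> bm_seminorms Y \<and> x \<in> bm_carrier Y \<and> 0 < r}"
        using closed Y.topspace_eq by (auto simp: bm_topology_def topology_generated_by_topspace)
      fix U assume "U \<in> {{y \<in> bm_carrier Y. q (bm_diff Y y x) < r} |q x r.
          q \<in> bm_seminorms Y \<and> x \<in> bm_carrier Y \<and> 0 < r}"
      then obtain q z r where U: "U = {y \<in> bm_carrier Y. q (bm_diff Y y z) < r}"
        and q: "q \<in> bm_seminorms Y" and z: "z \<in> bm_carrier Y" by blast
      obtain F C where F: "finite F" "F \<subseteq> bm_seminorms X" "0 \<le> C"
        "\<And>x. x \<in> bm_carrier X \<Longrightarrow> q (T x) \<le> C * (\<Sum>r\<in>F. r x)"
        using dom q unfolding dominated_def by meson
      show "openin (bm_topology X) (T -` U \<inter> topspace (bm_topology X))"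
        unfolding X.openin_iff
      proof (intro conjI ballI)
        fix x assume x: "x \<in> T -` U \<inter> topspace (bm_topology X)"
        define s where "s = r - q (bm_diff Y (T x) z)"
        \<comment> \<open>Adding \<open>1\<close> avoids a zero denominator and makes
          \<open>C * card F * d\<close> strictly smaller than \<open>s\<close>.\<close>
        define d where "d = s / (C * card F + 1)"
        have "0 < C * card F + 1" using F(3) by (smt (verit) mult_nonneg_nonneg of_nat_0_le_iff)
        moreover have "0 < s" using x by (simp add: s_def U)
        ultimately have d: "0 < d" "d * (C * card F + 1) = s" by (auto simp: d_def)
        have "y \<in> T -` U \<inter> topspace (bm_topology X)"
          if y: "y \<in> bm_carrier X" "\<forall>p\<in>F. p (bm_diff X y x) < d" for y
        proof -
          have "q (bm_diff Y (T y) (T x)) \<le> C * (\<Sum>p\<in>F. p (bm_diff X y x))"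
            using F(4) [of "bm_diff X y x"] x y by (simp add: diff)
          also have "\<dots> \<le> C * (\<Sum>p\<in>F. d)"
            using F y by (intro mult_left_mono sum_mono) (auto simp: less_imp_le)
          also have "\<dots> < s" using d by (simp add: algebra_simps)
          finally have "q (bm_diff Y (T y) (T x)) < s" .
          moreover have "q (bm_diff Y (T y) z)
              \<le> q (bm_diff Y (T y) (T x)) + q (bm_diff Y (T x) z)"
            using Y.seminorm_add [OF q, of "bm_diff Y (T y) (T x)" "bm_diff Y (T x) z"] x y z closed
            by (simp add: Y.diff_add_diff)
          ultimately show ?thesis using y closed by (simp add: U s_def)
        qed
        then show "\<exists>F d. finite F \<and> F \<subseteq> bm_seminorms X \<and> 0 < d \<and> (\<forall>y\<in>bm_carrier X.
            (\<forall>q\<in>F. q (bm_diff X y x) < d) \<longrightarrow> y \<in> T -` U \<inter> topspace (bm_topology X))"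
          using F d by blast
      qed auto
    qed
  qed
  then show ?thesis using lin by (simp add: cont_linear_def)
qed (simp add: cont_linear_def)

section \<open>Dual pairings\<close>

text \<open>The scalars in the shape of a bimodule, so that continuous functionals are instances of
  \<open>cont_linear\<close>.\<close>

definition complex_bimodule :: "(unit, complex) lc_bimodule" where
  "complex_bimodule =
     \<lparr>bm_carrier = UNIV, bm_add = (+), bm_scale = (*),
      bm_left = (\<lambda>_ z. z), bm_right = (\<lambda>z _. z), bm_seminorms = {cmod}\<rparr>"

lemma complex_bimodule_simps [simp]:
  "bm_carrier complex_bimodule = UNIV"
  "bm_add complex_bimodule = (+)"
  "bm_scale complex_bimodule = (*)"
  "bm_seminorms complex_bimodule = {cmod}"
  "bm_diff complex_bimodule = (-)"
  by (auto simp: complex_bimodule_def bm_diff_def fun_eq_iff)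

lemma bm_zero_complex [simp]: "bm_zero complex_bimodule = 0"
  by (simp add: bm_zero_def)

lemma lc_space_complex: "lc_space complex_bimodule"
  by unfold_locales (auto simp: algebra_simps norm_triangle_ineq norm_mult)

lemma bm_topology_complex: "bm_topology complex_bimodule = euclidean"
proof (rule topology_eq [THEN iffD2], intro allI)
  fix U :: "complex set"
  interpret lc_space complex_bimodule by (rule lc_space_complex)
  show "openin (bm_topology complex_bimodule) U = openin euclidean U"
  proof
    assume U: "openin (bm_topology complex_bimodule) U"
    have "\<exists>e>0. \<forall>y. dist y x < e \<longrightarrow> y \<in> U" if "x \<in> U" for x
    proof -
      have "\<exists>F d. F \<subseteq> {cmod} \<and> 0 < d \<and> (\<forall>y. (\<forall>q\<in>F. q (y - x) < d) \<longrightarrow> y \<in> U)"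
        using U that unfolding openin_iff by simp blast
      then obtain F d where F: "F \<subseteq> {cmod}" "0 < d"
        "\<forall>y. (\<forall>q\<in>F. q (y - x) < d) \<longrightarrow> y \<in> U"
        by blast
      then show ?thesis by (intro exI [of _ d]) (auto simp: dist_norm subset_iff)
    qed
    then show "openin euclidean U" by (simp add: open_dist)
  next
    assume "openin euclidean U"
    then have U: "\<exists>e>0. \<forall>y. dist y x < e \<longrightarrow> y \<in> U" if "x \<in> U" for x
      using that by (simp add: open_dist)
    show "openin (bm_topology complex_bimodule) U"
      unfolding openin_iff
    proof (intro conjI ballI)
      fix x assume "x \<in> U"
      with U obtain e where "e > 0" "\<forall>y. dist y x < e \<longrightarrow> y \<in> U" by blast
      then show "\<exists>F d. finite F \<and> F \<subseteq> bm_seminorms complex_bimodule \<and> 0 < d \<and>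
          (\<forall>y\<in>bm_carrier complex_bimodule. (\<forall>q\<in>F. q (bm_diff complex_bimodule y x) < d)
            \<longrightarrow> y \<in> U)"
        by (intro exI [of _ "{cmod}"] exI [of _ e]) (auto simp: dist_norm)
    qed simp
  qed
qed

abbreviation functional :: "('b, 'x) lc_bimodule \<Rightarrow> ('x \<Rightarrow> complex) \<Rightarrow> bool" where
  "functional X \<equiv> cont_linear X complex_bimodule"

lemma functional_iff: "functional X f \<longleftrightarrow>
    (\<forall>x\<in>bm_carrier X. \<forall>y\<in>bm_carrier X. f (bm_add X x y) = f x + f y) \<and>
    (\<forall>a. \<forall>x\<in>bm_carrier X. f (bm_scale X a x) = a * f x) \<and>
    dominated X (\<lambda>x. cmod (f x))"
  by (auto simp: cont_linear_def bm_linear_def)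

text \<open>Trades the topological continuity in the definition of the dual for a seminorm
  estimate.\<close>

lemma continuous_functionals_eq:
  assumes "lc_space X"
  shows "continuous_functionals X = {f \<in> extensional (bm_carrier X). functional X f}"
  using cont_linear_iff [OF assms lc_space_complex]
  by (auto simp: continuous_functionals_def bm_linear_def bm_topology_complex)

lemma dominated_cong:
  "(\<And>x. x \<in> bm_carrier X \<Longrightarrow> f x = g x) \<Longrightarrow> dominated X f \<longleftrightarrow> dominated X g"
  by (auto simp: dominated_def)

lemma functional_restrict:
  assumes "lc_space X"
  shows "functional X (restrict f (bm_carrier X)) \<longleftrightarrow> functional X f"
  using assms dominated_cong [of X "\<lambda>x. cmod (restrict f (bm_carrier X) x)" "\<lambda>x. cmod (f x)"]
  by (auto simp: functional_iff lc_space.add_closed lc_space.scale_closed)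

lemma functional_add: "\<lbrakk>functional X f; x \<in> bm_carrier X; y \<in> bm_carrier X\<rbrakk>
    \<Longrightarrow> f (bm_add X x y) = f x + f y"
  by (simp add: functional_iff)

lemma functional_scale: "\<lbrakk>functional X f; x \<in> bm_carrier X\<rbrakk> \<Longrightarrow> f (bm_scale X a x) = a * f x"
  by (simp add: functional_iff)

lemma functional_zero: "\<lbrakk>lc_space X; functional X f\<rbrakk> \<Longrightarrow> f (bm_zero X) = 0"
  using bm_linear_zero [OF _ lc_space_complex cont_linear_linear] by fastforce

lemma functional_diff: "\<lbrakk>lc_space X; functional X f; x \<in> bm_carrier X; y \<in> bm_carrier X\<rbrakk>
    \<Longrightarrow> f (bm_diff X x y) = f x - f y"
  using bm_linear_diff [of X complex_bimodule f] by (simp add: cont_linear_linear)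

lemma functional_bounded:
  "\<lbrakk>functional X f; bm_bounded X B\<rbrakk> \<Longrightarrow> bdd_above ((\<lambda>x. cmod (f x)) ` B)"
  by (rule dominated_bounded) (auto simp: functional_iff)

text \<open>Gives the homogeneity of the seminorms on a strong dual.\<close>

lemma real_SUP_cmult:
  fixes f :: "'x \<Rightarrow> real"
  assumes "B \<noteq> {}" "bdd_above (f ` B)" "0 \<le> a"
  shows "(SUP x\<in>B. a * f x) = a * (SUP x\<in>B. f x)"
proof (cases "a = 0")
  case True
  then show ?thesis using assms by simp
next
  case False
  with assms have a: "0 < a" by simp
  have le: "a * f x \<le> a * (SUP x\<in>B. f x)" if "x \<in> B" for x
    using a cSUP_upper [OF that assms(2)] by simp
  show ?thesis
  proof (rule antisym)
    show "(SUP x\<in>B. a * f x) \<le> a * (SUP x\<in>B. f x)"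
      using le by (intro cSUP_least assms(1))
    have "f x \<le> (SUP x\<in>B. a * f x) / a" if "x \<in> B" for x
    proof -
      have "a * f x \<le> (SUP x\<in>B. a * f x)"
        using le by (intro cSUP_upper that) (auto simp: bdd_above_def)
      then show ?thesis using a by (simp add: field_simps)
    qed
    then have "(SUP x\<in>B. f x) \<le> (SUP x\<in>B. a * f x) / a"
      by (intro cSUP_least assms(1))
    then show "a * (SUP x\<in>B. f x) \<le> (SUP x\<in>B. a * f x)"
      using a by (simp add: field_simps)
  qed
qed

section \<open>Bimodules with continuous translations and their duals\<close>

lemma scaleC_zero_left [simp]: "scaleC 0 x = (0 :: 'a::complex_algebra)"
  using scaleC_add_left [of 0 0 x] by simp

text \<open>Continuity is required of each translation by a fixed algebra element; this is the form
  that passes to the strong dual by transposition.\<close>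

locale lc_bimod = lc_space X for X :: "('b::complex_algebra, 'x) lc_bimodule" +
  assumes left_cont: "cont_linear X X (bm_left X b)"
    and right_cont: "cont_linear X X (\<lambda>x. bm_right X x b)"
    and left_scale: "x \<in> bm_carrier X \<Longrightarrow> bm_left X (scaleC a b) x = bm_scale X a (bm_left X b x)"
    and right_scale: "x \<in> bm_carrier X \<Longrightarrow> bm_right X x (scaleC a b) = bm_scale X a (bm_right X x b)"
begin

lemma left_closed [simp]: "x \<in> bm_carrier X \<Longrightarrow> bm_left X b x \<in> bm_carrier X"
  using bm_linear_closed [OF cont_linear_linear [OF left_cont]] .

lemma right_closed [simp]: "x \<in> bm_carrier X \<Longrightarrow> bm_right X x b \<in> bm_carrier X"
  using bm_linear_closed [OF cont_linear_linear [OF right_cont]] .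

lemma left_zero [simp]: "bm_left X b (bm_zero X) = bm_zero X"
  using bm_linear_zero [OF lc_space_axioms lc_space_axioms cont_linear_linear [OF left_cont]] .

lemma right_zero [simp]: "bm_right X (bm_zero X) b = bm_zero X"
  using bm_linear_zero [OF lc_space_axioms lc_space_axioms cont_linear_linear [OF right_cont]] .

lemma zero_left: "x \<in> bm_carrier X \<Longrightarrow> bm_left X 0 x = bm_zero X"
  using left_scale [of x 0 0] by (simp add: scale_0 scaleC_zero_left)

lemma zero_right: "x \<in> bm_carrier X \<Longrightarrow> bm_right X x 0 = bm_zero X"
  using right_scale [of x 0 0] by (simp add: scale_0 scaleC_zero_left)

lemma bounded_singleton: "x \<in> bm_carrier X \<Longrightarrow> bm_bounded X {x}"
  by (simp add: bm_bounded_def)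

end

text \<open>An axiomatic strong dual: \<open>D\<close> is the dual of \<open>X\<close> up to a
  renaming of its elements, and \<open>pair\<close> is evaluation. The copies in
  \<open>iterated_dual\<close> have elements of an arbitrary type, so functionals are reached only
  through such a pairing.\<close>

locale dual_pairing = lc_bimod X for X :: "('b::complex_algebra, 'x) lc_bimodule" +
  fixes D :: "('b, 'y) lc_bimodule" and pair :: "'y \<Rightarrow> 'x \<Rightarrow> complex"
  assumes pair_functional: "f \<in> bm_carrier D \<Longrightarrow> functional X (pair f)"
    and represented: "functional X u \<Longrightarrow> \<exists>f\<in>bm_carrier D. \<forall>x\<in>bm_carrier X. pair f x = u x"
    and pair_ext: "\<lbrakk>f \<in> bm_carrier D; g \<in> bm_carrier D;
      \<And>x. x \<in> bm_carrier X \<Longrightarrow> pair f x = pair g x\<rbrakk> \<Longrightarrow> f = g"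
    and dual_closed: "\<lbrakk>f \<in> bm_carrier D; g \<in> bm_carrier D\<rbrakk> \<Longrightarrow> bm_add D f g \<in> bm_carrier D"
      "f \<in> bm_carrier D \<Longrightarrow> bm_scale D a f \<in> bm_carrier D"
      "f \<in> bm_carrier D \<Longrightarrow> bm_left D b f \<in> bm_carrier D"
      "f \<in> bm_carrier D \<Longrightarrow> bm_right D f b \<in> bm_carrier D"
    and pair_add: "\<lbrakk>f \<in> bm_carrier D; g \<in> bm_carrier D; x \<in> bm_carrier X\<rbrakk>
      \<Longrightarrow> pair (bm_add D f g) x = pair f x + pair g x"
    and pair_scale: "\<lbrakk>f \<in> bm_carrier D; x \<in> bm_carrier X\<rbrakk>
      \<Longrightarrow> pair (bm_scale D a f) x = a * pair f x"
    and pair_left: "\<lbrakk>f \<in> bm_carrier D; x \<in> bm_carrier X\<rbrakk>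
      \<Longrightarrow> pair (bm_left D b f) x = pair f (bm_right X x b)"
    and pair_right: "\<lbrakk>f \<in> bm_carrier D; x \<in> bm_carrier X\<rbrakk>
      \<Longrightarrow> pair (bm_right D f b) x = pair f (bm_left X b x)"
    and dual_seminorm: "q \<in> bm_seminorms D \<Longrightarrow> \<exists>B. B \<noteq> {} \<and> bm_bounded X B \<and>
      (\<forall>f\<in>bm_carrier D. q f = (SUP x\<in>B. cmod (pair f x)))"
    and seminorm_of_bounded: "\<lbrakk>B \<noteq> {}; bm_bounded X B\<rbrakk> \<Longrightarrow> \<exists>q\<in>bm_seminorms D.
      \<forall>f\<in>bm_carrier D. q f = (SUP x\<in>B. cmod (pair f x))"
begin

lemma pair_le_SUP:
  assumes "f \<in> bm_carrier D" "bm_bounded X B" "x \<in> B"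
  shows "cmod (pair f x) \<le> (SUP x\<in>B. cmod (pair f x))"
  using functional_bounded [OF pair_functional] assms by (intro cSUP_upper)

text \<open>The seminorm of \<open>D\<close> belonging to \<open>B\<close> serves as
  \<open>g\<close>. Seminorms belong to nonempty bounded sets, so the empty set is treated
  apart.\<close>

lemma dominated_bounded_pairing:
  assumes "bm_bounded X B"
  obtains g where "dominated D g" "\<And>f x. \<lbrakk>f \<in> bm_carrier D; x \<in> B\<rbrakk> \<Longrightarrow> cmod (pair f x) \<le> g f"
proof (cases "B = {}")
  case True
  then show ?thesis using that dominated_zero by blast
next
  case False
  then obtain q where "q \<in> bm_seminorms D"
    "\<forall>f\<in>bm_carrier D. q f = (SUP x\<in>B. cmod (pair f x))"
    using seminorm_of_bounded assms by blast
  then show ?thesis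
    using pair_le_SUP [OF _ assms] by (intro that [of q]) (auto simp: dominated_seminorm)
qed

end

text \<open>Continuous maps preserve bounded sets, and the seminorm of \<open>B\<close> composed
  with \<open>T'\<close> is the seminorm of the image of \<open>B\<close> under
  \<open>T\<close>.\<close>

lemma cont_linear_transpose:
  assumes X: "dual_pairing X X' bX" and Y: "dual_pairing Y Y' bY" and T: "cont_linear X Y T"
    and closed: "\<And>f. f \<in> bm_carrier Y' \<Longrightarrow> T' f \<in> bm_carrier X'"
    and T': "\<And>f x. \<lbrakk>f \<in> bm_carrier Y'; x \<in> bm_carrier X\<rbrakk> \<Longrightarrow> bX (T' f) x = bY f (T x)"
  shows "cont_linear Y' X' T'"
  unfolding cont_linear_def
proof (intro conjI ballI)
  interpret X: dual_pairing X X' bX by (rule X)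
  interpret Y: dual_pairing Y Y' bY by (rule Y)
  have [simp]: "T x \<in> bm_carrier Y" if "x \<in> bm_carrier X" for x
    using T that by (simp add: cont_linear_def bm_linear_def)
  show "bm_linear Y' X' T'"
    unfolding bm_linear_def
    by (auto intro!: X.pair_ext simp: closed T' X.dual_closed Y.dual_closed
        X.pair_add Y.pair_add X.pair_scale Y.pair_scale)
  fix q assume "q \<in> bm_seminorms X'"
  then obtain B where B: "B \<noteq> {}" "bm_bounded X B"
    and q: "\<And>f. f \<in> bm_carrier X' \<Longrightarrow> q f = (SUP x\<in>B. cmod (bX f x))"
    using X.dual_seminorm by meson
  obtain r where r: "r \<in> bm_seminorms Y'"
    "\<And>f. f \<in> bm_carrier Y' \<Longrightarrow> r f = (SUP x\<in>T ` B. cmod (bY f x))"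
    using Y.seminorm_of_bounded [of "T ` B"] B cont_linear_bounded [OF T] by auto
  have "q (T' f) = r f" if "f \<in> bm_carrier Y'" for f
    using that B(2) by (auto simp: q r(2) closed image_image bm_bounded_def T' subset_iff intro!: SUP_cong)
  then show "dominated Y' (\<lambda>f. q (T' f))"
    using dominated_le [OF dominated_seminorm [OF r(1)]] by simp
qed

context dual_pairing
begin

lemma lc_space_dual: "lc_space D"
proof
  show "bm_carrier D \<noteq> {}"
  proof -
    have "functional X (\<lambda>_. 0)"
      by (simp add: functional_iff dominated_zero)
    then show ?thesis using represented by blast
  qed
  show "bm_seminorms D \<noteq> {}"
    using seminorm_of_bounded [of "{bm_zero X}"] bounded_singleton by auto
next
  fix q f g assume q: "q \<in> bm_seminorms D" and fg: "f \<in> bm_carrier D" "g \<in> bm_carrier D"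
  obtain B where B: "B \<noteq> {}" "bm_bounded X B"
    and q: "\<And>f. f \<in> bm_carrier D \<Longrightarrow> q f = (SUP x\<in>B. cmod (pair f x))"
    using dual_seminorm [OF q] by meson
  have B': "x \<in> bm_carrier X" if "x \<in> B" for x using B that by (auto simp: bm_bounded_def)
  show "q (bm_add D f g) \<le> q f + q g"
    unfolding q [OF fg(1)] q [OF fg(2)] q [OF dual_closed(1) [OF fg]]
  proof (rule cSUP_least [OF B(1)])
    fix x assume x: "x \<in> B"
    have "cmod (pair (bm_add D f g) x) \<le> cmod (pair f x) + cmod (pair g x)"
      using fg B' [OF x] by (simp add: pair_add norm_triangle_ineq)
    then show "cmod (pair (bm_add D f g) x)
        \<le> (SUP x\<in>B. cmod (pair f x)) + (SUP x\<in>B. cmod (pair g x))"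
      using pair_le_SUP [OF fg(1) B(2) x] pair_le_SUP [OF fg(2) B(2) x] by linarith
  qed
next
  fix q f a assume q: "q \<in> bm_seminorms D" and f: "f \<in> bm_carrier D"
  obtain B where B: "B \<noteq> {}" "bm_bounded X B"
    and q: "\<And>f. f \<in> bm_carrier D \<Longrightarrow> q f = (SUP x\<in>B. cmod (pair f x))"
    using dual_seminorm [OF q] by meson
  have B': "x \<in> bm_carrier X" if "x \<in> B" for x using B that by (auto simp: bm_bounded_def)
  have "q (bm_scale D a f) = (SUP x\<in>B. cmod a * cmod (pair f x))"
    using B' by (auto simp: q dual_closed f pair_scale norm_mult intro!: SUP_cong)
  also have "\<dots> = cmod a * (SUP x\<in>B. cmod (pair f x))"
    using B functional_bounded [OF pair_functional [OF f]] by (intro real_SUP_cmult) auto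
  finally show "q (bm_scale D a f) = cmod a * q f"
    by (simp add: q f)
qed (auto intro!: pair_ext simp: dual_closed pair_add pair_scale algebra_simps)

text \<open>The left action on the dual is the transpose of right translation on \<open>X\<close>,
  and the right action that of left translation.\<close>

lemma lc_bimod_dual: "lc_bimod D"
proof -
  have "cont_linear D D (bm_left D b)" "cont_linear D D (\<lambda>f. bm_right D f b)" for b
    using cont_linear_transpose [OF dual_pairing_axioms dual_pairing_axioms right_cont]
      cont_linear_transpose [OF dual_pairing_axioms dual_pairing_axioms left_cont]
    by (auto simp: dual_closed pair_left pair_right)
  then show ?thesis
    by (intro lc_bimod.intro lc_bimod_axioms.intro lc_space_dual)
      (auto intro!: pair_ext simp: dual_closed pair_left pair_right pair_scale
        left_scale right_scale functional_scale [OF pair_functional])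
qed

end

text \<open>Connects the abstract pairing with \<open>iterated_dual\<close>: a copy of the strong
  dual made along an injective encoding is paired with \<open>X\<close> by decoding.\<close>

lemma dual_pairing_rename_strong_dual:
  assumes X: "lc_bimod X" and inj: "inj_on h (continuous_functionals X)"
  shows "dual_pairing X (rename_bimodule h (strong_dual X))
    (the_inv_into (continuous_functionals X) h)"
proof -
  interpret lc_bimod X by (rule X)
  let ?F = "continuous_functionals X"
  let ?D = "rename_bimodule h (strong_dual X)"
  let ?g = "the_inv_into ?F h"
  have F: "f \<in> ?F \<longleftrightarrow> f \<in> extensional (bm_carrier X) \<and> functional X f" for f
    by (simp add: continuous_functionals_eq lc_space_axioms)
  have gh [simp]: "?g (h f) = f" if "f \<in> ?F" for f
    using that inj by (simp add: the_inv_into_f_f)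
  \<comment> \<open>Elements of the dual are extensional functions, so the results of all operations
    have to be restricted to the carrier.\<close>
  have restr: "restrict f (bm_carrier X) \<in> ?F" if "functional X f" for f
    using that by (simp add: F functional_restrict [OF lc_space_axioms])
  have cl: "(\<lambda>x\<in>bm_carrier X. f x + g x) \<in> ?F" "(\<lambda>x\<in>bm_carrier X. a * f x) \<in> ?F"
    if "f \<in> ?F" "g \<in> ?F" for f g a
  proof -
    have "dominated X (\<lambda>x. cmod (f x + g x))"
      using that dominated_add [of "\<lambda>x. cmod (f x)" "\<lambda>x. cmod (g x)"]
      by (auto simp: F functional_iff intro: dominated_le norm_triangle_ineq)
    then show "(\<lambda>x\<in>bm_carrier X. f x + g x) \<in> ?F"
      using that by (intro restr) (auto simp: F functional_iff algebra_simps)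
    have "dominated X (\<lambda>x. cmod (a * f x))"
      using that dominated_cmult [of X "\<lambda>x. cmod (f x)" "cmod a"]
      by (auto simp: F functional_iff norm_mult)
    then show "(\<lambda>x\<in>bm_carrier X. a * f x) \<in> ?F"
      using that by (intro restr) (auto simp: F functional_iff algebra_simps)
  qed
  have act: "(\<lambda>x\<in>bm_carrier X. f (bm_right X x b)) \<in> ?F" "(\<lambda>x\<in>bm_carrier X. f (bm_left X b x)) \<in> ?F"
    if "f \<in> ?F" for f b
    using that cont_linear_compose [OF lc_space_axioms right_cont, of complex_bimodule f b]
      cont_linear_compose [OF lc_space_axioms left_cont, of complex_bimodule f b]
    by (simp_all add: F functional_restrict [OF lc_space_axioms])
  have carr: "bm_carrier ?D = h ` ?F"
    by (simp add: rename_bimodule_def strong_dual_def Let_def)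
  have ops: "bm_add ?D (h f) (h g) = h (\<lambda>x\<in>bm_carrier X. f x + g x)"
    "bm_scale ?D a (h f) = h (\<lambda>x\<in>bm_carrier X. a * f x)"
    "bm_left ?D b (h f) = h (\<lambda>x\<in>bm_carrier X. f (bm_right X x b))"
    "bm_right ?D (h f) b = h (\<lambda>x\<in>bm_carrier X. f (bm_left X b x))"
    if "f \<in> ?F" "g \<in> ?F" for f g a b
    using that by (simp_all add: rename_bimodule_def strong_dual_def Let_def)
  have sn: "bm_seminorms ?D = {(\<lambda>f. SUP x\<in>S. cmod (f x)) \<circ> ?g | S. S \<noteq> {} \<and> bm_bounded X S}"
    by (auto simp: rename_bimodule_def strong_dual_def Let_def)
  show ?thesis
  proof
    fix g assume "functional X g"
    then show "\<exists>f\<in>bm_carrier ?D. \<forall>x\<in>bm_carrier X. ?g f x = g x"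
      using restr by (intro bexI [of _ "h (restrict g (bm_carrier X))"]) (auto simp: carr)
  next
    fix f g assume "f \<in> bm_carrier ?D" "g \<in> bm_carrier ?D"
      and eq: "\<And>x. x \<in> bm_carrier X \<Longrightarrow> ?g f x = ?g g x"
    then obtain f' g' where *: "f = h f'" "g = h g'" "f' \<in> ?F" "g' \<in> ?F" by (auto simp: carr)
    then have "f' = g'"
      using eq by (intro extensionalityI [of _ "bm_carrier X"]) (auto simp: F)
    then show "f = g" using * by simp
  next
    show "\<exists>B. B \<noteq> {} \<and> bm_bounded X B \<and> (\<forall>f\<in>bm_carrier ?D. q f = (SUP x\<in>B. cmod (?g f x)))"
      if "q \<in> bm_seminorms ?D" for q
      using that by (auto simp: sn)
    show "\<exists>q\<in>bm_seminorms ?D. \<forall>f\<in>bm_carrier ?D. q f = (SUP x\<in>B. cmod (?g f x))"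
      if "B \<noteq> {}" "bm_bounded X B" for B
      using that by (auto simp: sn intro!: exI [of _ "(\<lambda>f. SUP x\<in>B. cmod (f x)) \<circ> ?g"])
  qed (use cl act in \<open>auto simp: carr ops F\<close>)
qed

section \<open>Duals of the unitization\<close>

lemma regular_bimodule_simps [simp]:
  "bm_carrier (regular_bimodule p) = UNIV"
  "bm_add (regular_bimodule p) = (+)"
  "bm_scale (regular_bimodule p) = scaleC"
  "bm_left (regular_bimodule p) = (*)"
  "bm_right (regular_bimodule p) = (*)"
  "bm_seminorms (regular_bimodule p) = range p"
  by (simp_all add: regular_bimodule_def)

text \<open>Submultiplicativity bounds translation by \<open>b\<close> with the constant
  \<open>p l b\<close> for the seminorm \<open>p l\<close>.\<close>

lemma lc_bimod_regular:
  assumes "\<And>l. submult_seminorm (p l)"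
  shows "lc_bimod (regular_bimodule p)"
proof -
  have add: "p l (x + y) \<le> p l x + p l y" and scale: "p l (scaleC a x) = cmod a * p l x"
    and mult: "p l (x * y) \<le> p l x * p l y" for l x y a
    using assms [of l] by (auto simp: submult_seminorm_def)
  interpret lc_space "regular_bimodule p"
  proof
    show "q (bm_add (regular_bimodule p) x y) \<le> q x + q y"
      "q (bm_scale (regular_bimodule p) a x) = cmod a * q x"
      if "q \<in> bm_seminorms (regular_bimodule p)" for q x y a
      using that add scale by auto
  qed (simp_all add: ac_simps scaleC_add_right scaleC_add_left scaleC_scaleC scaleC_one)
  have nonneg: "0 \<le> p l x" for l x
    using seminorm_nonneg [of "p l" x] by simp
  show ?thesis
  proof
    show "cont_linear (regular_bimodule p) (regular_bimodule p) (bm_left (regular_bimodule p) b)"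
      for b
      unfolding cont_linear_def
    proof (intro conjI ballI)
      fix q assume "q \<in> bm_seminorms (regular_bimodule p)"
      then obtain l where q: "q = p l" by auto
      have "dominated (regular_bimodule p) (\<lambda>x. p l b * p l x)"
        by (intro dominated_cmult dominated_seminorm) (auto simp: nonneg)
      then show "dominated (regular_bimodule p) (\<lambda>x. q (bm_left (regular_bimodule p) b x))"
        by (rule dominated_le) (simp add: q mult)
    qed (simp add: bm_linear_def distrib_left mult_scaleC_right)
    show "cont_linear (regular_bimodule p) (regular_bimodule p)
        (\<lambda>x. bm_right (regular_bimodule p) x b)" for b
      unfolding cont_linear_def
    proof (intro conjI ballI)
      fix q assume "q \<in> bm_seminorms (regular_bimodule p)"
      then obtain l where q: "q = p l" by auto
      have "dominated (regular_bimodule p) (\<lambda>x. p l b * p l x)"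
        by (intro dominated_cmult dominated_seminorm) (auto simp: nonneg)
      then show "dominated (regular_bimodule p) (\<lambda>x. q (bm_right (regular_bimodule p) x b))"
        by (rule dominated_le) (use mult in \<open>simp add: q mult.commute [of "p l b"]\<close>)
    qed (simp add: bm_linear_def distrib_right mult_scaleC_left)
  qed (simp_all add: mult_scaleC_left mult_scaleC_right)
qed

lemma bm_zero_regular:
  assumes "\<And>l. submult_seminorm (p l)"
  shows "bm_zero (regular_bimodule p) = 0"
proof -
  interpret lc_bimod "regular_bimodule p" by (rule lc_bimod_regular) (rule assms)
  show ?thesis using scale_0 [of 0] by (simp add: scaleC_zero_left)
qed

section \<open>Renamed copies of a bimodule\<close>

lemma rename_simps:
  assumes "inj_on h (bm_carrier X)"
  shows "bm_carrier (rename_bimodule h X) = h ` bm_carrier X"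
    and "\<lbrakk>x \<in> bm_carrier X; y \<in> bm_carrier X\<rbrakk>
      \<Longrightarrow> bm_add (rename_bimodule h X) (h x) (h y) = h (bm_add X x y)"
    and "x \<in> bm_carrier X \<Longrightarrow> bm_scale (rename_bimodule h X) a (h x) = h (bm_scale X a x)"
    and "x \<in> bm_carrier X \<Longrightarrow> bm_left (rename_bimodule h X) b (h x) = h (bm_left X b x)"
    and "x \<in> bm_carrier X \<Longrightarrow> bm_right (rename_bimodule h X) (h x) b = h (bm_right X x b)"
    and "bm_seminorms (rename_bimodule h X)
      = (\<lambda>q. q \<circ> the_inv_into (bm_carrier X) h) ` bm_seminorms X"
  using assms by (simp_all add: rename_bimodule_def Let_def the_inv_into_f_f)

text \<open>Serves degree zero, where the algebra itself is renamed; in higher degrees the bimodule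
  laws come from the dual pairing.\<close>

lemma rename_lc_bimod:
  assumes X: "lc_bimod X" and inj: "inj_on h (bm_carrier X)"
  shows "lc_bimod (rename_bimodule h X)"
    and "cont_linear X (rename_bimodule h X) h"
    and "cont_linear (rename_bimodule h X) X (the_inv_into (bm_carrier X) h)"
proof -
  interpret X: lc_bimod X by (rule X)
  let ?Y = "rename_bimodule h X" and ?g = "the_inv_into (bm_carrier X) h"
  note simps = rename_simps [OF inj]
  have gh [simp]: "?g (h x) = x" if "x \<in> bm_carrier X" for x
    using that inj by (simp add: the_inv_into_f_f)
  interpret Y: lc_space ?Y
  proof
    show "bm_seminorms ?Y \<noteq> {}" "bm_carrier ?Y \<noteq> {}"
      using X.carrier_nonempty X.seminorms_nonempty by (auto simp: simps)
    show "bm_add ?Y x y = bm_add ?Y y x" if "x \<in> bm_carrier ?Y" "y \<in> bm_carrier ?Y" for x y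
      using that by (auto simp: simps X.add_commute)
  qed (auto simp: simps X.add_assoc X.add_scale_0 X.scale_add X.add_scale X.scale_scale
      X.scale_one X.seminorm_add X.seminorm_scale)
  show h: "cont_linear X ?Y h"
    unfolding cont_linear_def
  proof (intro conjI ballI)
    fix q assume "q \<in> bm_seminorms ?Y"
    then obtain q' where q': "q' \<in> bm_seminorms X" "q = q' \<circ> ?g" by (auto simp: simps)
    show "dominated X (\<lambda>x. q (h x))"
      by (rule dominated_le [OF dominated_seminorm [OF q'(1)]]) (simp add: q')
  qed (simp add: bm_linear_def simps)
  show g: "cont_linear ?Y X ?g"
    unfolding cont_linear_def
  proof (intro conjI ballI)
    fix q assume "q \<in> bm_seminorms X"
    then have "q \<circ> ?g \<in> bm_seminorms ?Y" by (auto simp: simps)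
    then show "dominated ?Y (\<lambda>x. q (?g x))"
      using dominated_seminorm [of "q \<circ> ?g" ?Y] by (simp add: o_def)
  qed (auto simp: bm_linear_def simps)
  have "cont_linear ?Y ?Y (bm_left ?Y b)" "cont_linear ?Y ?Y (\<lambda>y. bm_right ?Y y b)" for b
  proof -
    \<comment> \<open>The actions on the copy are the old ones conjugated by \<open>h\<close>, hence
      composites of continuous maps.\<close>
    have "cont_linear ?Y ?Y (\<lambda>y. h (bm_left X b (?g y)))"
      "cont_linear ?Y ?Y (\<lambda>y. h (bm_right X (?g y) b))"
      by (rule cont_linear_compose [OF Y.lc_space_axioms g
            cont_linear_compose [OF X.lc_space_axioms X.left_cont h]],
          rule cont_linear_compose [OF Y.lc_space_axioms g
            cont_linear_compose [OF X.lc_space_axioms X.right_cont h]])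
    then show "cont_linear ?Y ?Y (bm_left ?Y b)" "cont_linear ?Y ?Y (\<lambda>y. bm_right ?Y y b)"
      by (simp_all add: rename_bimodule_def Let_def)
  qed
  then show "lc_bimod ?Y"
    by (intro lc_bimod.intro lc_bimod_axioms.intro Y.lc_space_axioms)
      (auto simp: simps X.left_scale X.right_scale)
qed

text \<open>The splitting of \<open>Y\<close> into a copy of \<open>X\<close> and a line:
  \<open>S\<close> and \<open>P\<close> are the inclusion and the projection, \<open>E\<close> spans
  the line and \<open>G\<close> is its coordinate. The actions are left to two extensions, as their
  form depends on the parity of the degree.\<close>

locale unitized =
  X: lc_bimod X + Y: lc_bimod Y
  for X :: "('a::complex_algebra, 'x) lc_bimodule" and Y :: "('a unitization, 'y) lc_bimodule" +
  fixes S :: "'x \<Rightarrow> 'y" and P :: "'y \<Rightarrow> 'x" and E :: 'y and G :: "'y \<Rightarrow> complex"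
  assumes S: "cont_linear X Y S" and P: "cont_linear Y X P"
    and E [simp]: "E \<in> bm_carrier Y" and G: "functional Y G"
    and P_S [simp]: "x \<in> bm_carrier X \<Longrightarrow> P (S x) = x"
    and G_S [simp]: "x \<in> bm_carrier X \<Longrightarrow> G (S x) = 0"
    and P_E [simp]: "P E = bm_zero X"
    and G_E [simp]: "G E = 1"
    and decomposition: "y \<in> bm_carrier Y \<Longrightarrow> bm_add Y (S (P y)) (bm_scale Y (G y) E) = y"
begin

lemma S_closed [simp]: "x \<in> bm_carrier X \<Longrightarrow> S x \<in> bm_carrier Y"
  using bm_linear_closed [OF cont_linear_linear [OF S]] .

lemma P_closed [simp]: "y \<in> bm_carrier Y \<Longrightarrow> P y \<in> bm_carrier X"
  using bm_linear_closed [OF cont_linear_linear [OF P]] .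

lemma S_add: "\<lbrakk>x \<in> bm_carrier X; z \<in> bm_carrier X\<rbrakk> \<Longrightarrow> S (bm_add X x z) = bm_add Y (S x) (S z)"
  using bm_linear_add [OF cont_linear_linear [OF S]] .

lemma S_scale: "x \<in> bm_carrier X \<Longrightarrow> S (bm_scale X a x) = bm_scale Y a (S x)"
  using bm_linear_scale [OF cont_linear_linear [OF S]] .

lemma P_add: "\<lbrakk>y \<in> bm_carrier Y; z \<in> bm_carrier Y\<rbrakk> \<Longrightarrow> P (bm_add Y y z) = bm_add X (P y) (P z)"
  using bm_linear_add [OF cont_linear_linear [OF P]] .

lemma P_scale: "y \<in> bm_carrier Y \<Longrightarrow> P (bm_scale Y a y) = bm_scale X a (P y)"
  using bm_linear_scale [OF cont_linear_linear [OF P]] .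

lemma P_diff: "\<lbrakk>y \<in> bm_carrier Y; z \<in> bm_carrier Y\<rbrakk>
    \<Longrightarrow> P (bm_diff Y y z) = bm_diff X (P y) (P z)"
  using bm_linear_diff [OF Y.lc_space_axioms cont_linear_linear [OF P]] .

lemmas G_add = functional_add [OF G]
  and G_scale = functional_scale [OF G]
  and G_diff = functional_diff [OF Y.lc_space_axioms G]

text \<open>Reduces identities in \<open>Y\<close> to the two coordinates, in which the actions are
  described.\<close>

lemma unitized_eqI:
  assumes "y \<in> bm_carrier Y" "z \<in> bm_carrier Y" "P y = P z" "G y = G z"
  shows "y = z"
  by (rule trans [OF decomposition [OF assms(1), symmetric, unfolded assms(3,4)]
        decomposition [OF assms(2)]])

end

text \<open>Dualizing swaps the maps: the new inclusion is the transpose of \<open>P\<close>, the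
  new projection that of \<open>S\<close>; the new vector represents \<open>G\<close> and the new
  coordinate is evaluation at \<open>E\<close>. The formulas for the new projection and coordinate
  are exported, since the action laws are stated in these.\<close>

lemma unitized_dual:
  assumes "unitized X Y S P E G" and X': "dual_pairing X X' bX" and Y': "dual_pairing Y Y' bY"
  obtains S' P' E' G' where "unitized X' Y' S' P' E' G'"
    and "\<And>f x. \<lbrakk>f \<in> bm_carrier Y'; x \<in> bm_carrier X\<rbrakk> \<Longrightarrow> bX (P' f) x = bY f (S x)"
    and "\<And>f. G' f = bY f E"
proof -
  interpret unitized X Y S P E G by fact
  interpret X': dual_pairing X X' bX by (rule X')
  interpret Y': dual_pairing Y Y' bY by (rule Y')
  have "\<exists>f'\<in>bm_carrier Y'. \<forall>y\<in>bm_carrier Y. bY f' y = bX f (P y)" if "f \<in> bm_carrier X'" for f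
    by (rule Y'.represented [OF cont_linear_compose
          [OF Y.lc_space_axioms P X'.pair_functional [OF that]]])
  then obtain S' where S': "\<And>f. f \<in> bm_carrier X' \<Longrightarrow> S' f \<in> bm_carrier Y'"
    "\<And>f y. \<lbrakk>f \<in> bm_carrier X'; y \<in> bm_carrier Y\<rbrakk> \<Longrightarrow> bY (S' f) y = bX f (P y)"
    by metis
  have "\<exists>f'\<in>bm_carrier X'. \<forall>x\<in>bm_carrier X. bX f' x = bY f (S x)" if "f \<in> bm_carrier Y'" for f
    by (rule X'.represented [OF cont_linear_compose
          [OF X.lc_space_axioms S Y'.pair_functional [OF that]]])
  then obtain P' where P': "\<And>f. f \<in> bm_carrier Y' \<Longrightarrow> P' f \<in> bm_carrier X'"
    "\<And>f x. \<lbrakk>f \<in> bm_carrier Y'; x \<in> bm_carrier X\<rbrakk> \<Longrightarrow> bX (P' f) x = bY f (S x)"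
    by metis
  obtain E' where E': "E' \<in> bm_carrier Y'" "\<And>y. y \<in> bm_carrier Y \<Longrightarrow> bY E' y = G y"
    using Y'.represented [OF G] by blast
  have "unitized X' Y' S' P' E' (\<lambda>f. bY f E)"
  proof (intro unitized.intro unitized_axioms.intro X'.lc_bimod_dual Y'.lc_bimod_dual)
    show "cont_linear X' Y' S'" by (rule cont_linear_transpose [OF Y' X' P S'])
    show "cont_linear Y' X' P'" by (rule cont_linear_transpose [OF X' Y' S P'])
    interpret D: lc_bimod X' by (rule X'.lc_bimod_dual)
    interpret D': lc_bimod Y' by (rule Y'.lc_bimod_dual)
    show "functional Y' (\<lambda>f. bY f E)"
    proof -
      obtain g where "dominated Y' g" "\<And>f x. \<lbrakk>f \<in> bm_carrier Y'; x \<in> {E}\<rbrakk> \<Longrightarrow> cmod (bY f x) \<le> g f"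
        using Y'.dominated_bounded_pairing [OF Y.bounded_singleton [OF E]] by blast
      then have "dominated Y' (\<lambda>f. cmod (bY f E))"
        by (auto intro: dominated_le)
      then show ?thesis by (simp add: functional_iff Y'.pair_add Y'.pair_scale)
    qed
    have zero: "bX (bm_zero X') x = 0" if "x \<in> bm_carrier X" for x
      using X'.pair_scale [of "bm_zero X'" x 0] that by simp
    show "P' E' = bm_zero X'"
      by (rule X'.pair_ext) (auto simp: P' E' zero)
    show "bm_add Y' (S' (P' f)) (bm_scale Y' (bY f E) E') = f" if f: "f \<in> bm_carrier Y'" for f
    proof (rule Y'.pair_ext)
      fix y assume y: "y \<in> bm_carrier Y"
      \<comment> \<open>The decomposition in the dual is the old decomposition of \<open>y\<close>,
        evaluated by \<open>f\<close>.\<close>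
      have "bY f y = bY f (bm_add Y (S (P y)) (bm_scale Y (G y) E))"
        using decomposition y by simp
      also have "\<dots> = bY f (S (P y)) + G y * bY f E"
        using f y functional_add [OF Y'.pair_functional [OF f]]
          functional_scale [OF Y'.pair_functional [OF f]] by simp
      finally show "bY (bm_add Y' (S' (P' f)) (bm_scale Y' (bY f E) E')) y = bY f y"
        using f y by (simp add: Y'.pair_add Y'.pair_scale S' P' E')
    qed (use f in \<open>auto simp: S' P' E'\<close>)
  qed (auto intro!: X'.pair_ext simp: S' P' E' functional_zero [OF X.lc_space_axioms X'.pair_functional])
  then show ?thesis using that P' by blast
qed

text \<open>Only preservation of bounded sets passes easily from one even dual to the next, so
  continuity of \<open>i\<close> is not part of the invariant.\<close>

locale unitized_even = unitized X Y S P E G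
  for p :: "nat \<Rightarrow> 'a::complex_algebra \<Rightarrow> real"
    and X :: "('a, 'x) lc_bimodule" and Y :: "('a unitization, 'y) lc_bimodule" and S P E G +
  fixes i :: "'a \<Rightarrow> 'x"
  assumes P_left: "y \<in> bm_carrier Y \<Longrightarrow> P (bm_left Y b y) =
      bm_add X (bm_add X (bm_left X (algebra_part b) (P y)) (bm_scale X (G y) (i (algebra_part b))))
        (bm_scale X (scalar_part b) (P y))"
    and P_right: "y \<in> bm_carrier Y \<Longrightarrow> P (bm_right Y y b) =
      bm_add X (bm_add X (bm_right X (P y) (algebra_part b)) (bm_scale X (G y) (i (algebra_part b))))
        (bm_scale X (scalar_part b) (P y))"
    and G_left: "y \<in> bm_carrier Y \<Longrightarrow> G (bm_left Y b y) = scalar_part b * G y"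
    and G_right: "y \<in> bm_carrier Y \<Longrightarrow> G (bm_right Y y b) = scalar_part b * G y"
    and i_closed [simp]: "i a \<in> bm_carrier X"
    and i_add: "i (a + a') = bm_add X (i a) (i a')"
    and i_scale: "i (scaleC c a) = bm_scale X c (i a)"
    and i_mult_left: "i (a * a') = bm_left X a (i a')"
    and i_mult_right: "i (a * a') = bm_right X (i a) a'"
    and i_bounded: "bm_bounded (regular_bimodule p) B \<Longrightarrow> bm_bounded X (i ` B)"

text \<open>\<open>j a\<close> stands for evaluation at the \<open>i a\<close> of the preceding
  degree. The last law is equicontinuity of \<open>j\<close> over bounded sets, the dual form of
  \<open>i_bounded\<close>.\<close>

locale unitized_odd = unitized X Y S P E G
  for p :: "nat \<Rightarrow> 'a::complex_algebra \<Rightarrow> real"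
    and X :: "('a, 'x) lc_bimodule" and Y :: "('a unitization, 'y) lc_bimodule" and S P E G +
  fixes j :: "'a \<Rightarrow> 'x \<Rightarrow> complex"
  assumes P_left: "y \<in> bm_carrier Y \<Longrightarrow> P (bm_left Y b y) =
      bm_add X (bm_left X (algebra_part b) (P y)) (bm_scale X (scalar_part b) (P y))"
    and P_right: "y \<in> bm_carrier Y \<Longrightarrow> P (bm_right Y y b) =
      bm_add X (bm_right X (P y) (algebra_part b)) (bm_scale X (scalar_part b) (P y))"
    and G_left: "y \<in> bm_carrier Y \<Longrightarrow> G (bm_left Y b y) = j (algebra_part b) (P y) + scalar_part b * G y"
    and G_right: "y \<in> bm_carrier Y \<Longrightarrow> G (bm_right Y y b) = j (algebra_part b) (P y) + scalar_part b * G y"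
    and j_functional: "functional X (j a)"
    and j_add: "x \<in> bm_carrier X \<Longrightarrow> j (a + a') x = j a x + j a' x"
    and j_scale: "x \<in> bm_carrier X \<Longrightarrow> j (scaleC c a) x = c * j a x"
    and j_mult_left: "x \<in> bm_carrier X \<Longrightarrow> j (a * a') x = j a (bm_left X a' x)"
    and j_mult_right: "x \<in> bm_carrier X \<Longrightarrow> j (a * a') x = j a' (bm_right X x a)"
    and j_bounded: "bm_bounded (regular_bimodule p) B \<Longrightarrow>
      \<exists>g. dominated X g \<and> (\<forall>a\<in>B. \<forall>x\<in>bm_carrier X. cmod (j a x) \<le> g x)"

text \<open>Here \<open>j a\<close> is the pairing with \<open>i a\<close>, and the dual seminorm of
  the bounded image of \<open>B\<close> under \<open>i\<close> gives equicontinuity. The actions on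
  the dual are read off from those of \<open>Y\<close> on \<open>S x\<close> and on
  \<open>E\<close>.\<close>

lemma unitized_even_dual:
  assumes "unitized_even p X Y S P E G i"
    and X': "dual_pairing X X' bX" and Y': "dual_pairing Y Y' bY"
  shows "\<exists>S' P' E' G' j. unitized_odd p X' Y' S' P' E' G' j"
proof -
  interpret unitized_even p X Y S P E G i by fact
  interpret X': dual_pairing X X' bX by (rule X')
  interpret Y': dual_pairing Y Y' bY by (rule Y')
  obtain S' P' E' G' where U': "unitized X' Y' S' P' E' G'"
    and bP: "\<And>f x. \<lbrakk>f \<in> bm_carrier Y'; x \<in> bm_carrier X\<rbrakk> \<Longrightarrow> bX (P' f) x = bY f (S x)"
    and G'_eq: "\<And>f. G' f = bY f E"
    using unitized_dual [OF unitized_axioms X' Y'] by blast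
  interpret U': unitized X' Y' S' P' E' G' by (rule U')
  define j where "j a f = bX f (i a)" for a f
  \<comment> \<open>\<open>G\<close> vanishes at \<open>S x\<close>, so the terms with
    \<open>i\<close> drop out and the copy of \<open>X\<close> is invariant.\<close>
  have S_right: "bm_right Y (S x) b
      = S (bm_add X (bm_right X x (algebra_part b)) (bm_scale X (scalar_part b) x))"
    and S_left: "bm_left Y b (S x)
      = S (bm_add X (bm_left X (algebra_part b) x) (bm_scale X (scalar_part b) x))"
    if "x \<in> bm_carrier X" for x b
    using that by (auto intro!: unitized_eqI simp: P_left P_right G_left G_right X.scale_0)
  \<comment> \<open>The component in the copy of \<open>X\<close> is the source of the
    \<open>j\<close> term in the dual coordinate.\<close>
  have E_right: "bm_right Y E b = bm_add Y (S (i (algebra_part b))) (bm_scale Y (scalar_part b) E)"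
    and E_left: "bm_left Y b E = bm_add Y (S (i (algebra_part b))) (bm_scale Y (scalar_part b) E)"
    for b
    by (auto intro!: unitized_eqI simp: P_left P_right G_left G_right P_add P_scale G_add G_scale
        X.scale_one)
  have "unitized_odd p X' Y' S' P' E' G' j"
  proof (intro unitized_odd.intro unitized_odd_axioms.intro U')
    fix y b assume y: "y \<in> bm_carrier Y'"
    note lin = functional_add [OF Y'.pair_functional [OF y]]
      functional_scale [OF Y'.pair_functional [OF y]]
      functional_add [OF X'.pair_functional [OF U'.P_closed [OF y]]]
      functional_scale [OF X'.pair_functional [OF U'.P_closed [OF y]]]
    show "P' (bm_left Y' b y) = bm_add X' (bm_left X' (algebra_part b) (P' y))
        (bm_scale X' (scalar_part b) (P' y))"
      using y by (intro X'.pair_ext)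
        (auto simp: bP Y'.pair_left S_right X'.pair_add X'.pair_left X'.pair_scale S_add S_scale lin)
    show "P' (bm_right Y' y b) = bm_add X' (bm_right X' (P' y) (algebra_part b))
        (bm_scale X' (scalar_part b) (P' y))"
      using y by (intro X'.pair_ext)
        (auto simp: bP Y'.pair_right S_left X'.pair_add X'.pair_right X'.pair_scale S_add S_scale lin)
    show "G' (bm_left Y' b y) = j (algebra_part b) (P' y) + scalar_part b * G' y"
      "G' (bm_right Y' y b) = j (algebra_part b) (P' y) + scalar_part b * G' y"
      using y by (simp_all add: G'_eq Y'.pair_left Y'.pair_right E_left E_right lin j_def bP)
  next
    show "functional X' (j a)" for a
    proof -
      obtain g where "dominated X' g" "\<And>f x. \<lbrakk>f \<in> bm_carrier X'; x \<in> {i a}\<rbrakk> \<Longrightarrow> cmod (bX f x) \<le> g f"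
        using X'.dominated_bounded_pairing [OF X.bounded_singleton [OF i_closed]] by blast
      then have "dominated X' (\<lambda>f. cmod (bX f (i a)))"
        by (auto intro: dominated_le)
      then show ?thesis by (simp add: functional_iff X'.pair_add X'.pair_scale j_def)
    qed
  next
    fix B assume "bm_bounded (regular_bimodule p) B"
    then show "\<exists>g. dominated X' g \<and> (\<forall>a\<in>B. \<forall>x\<in>bm_carrier X'. cmod (j a x) \<le> g x)"
      using X'.dominated_bounded_pairing [OF i_bounded] unfolding j_def by (metis imageI)
  next
    fix x a b assume x: "x \<in> bm_carrier X'"
    show "j (a * b) x = j a (bm_left X' b x)"
      using x by (simp add: j_def i_mult_right X'.pair_left)
    show "j (a * b) x = j b (bm_right X' x a)"
      using x by (simp add: j_def i_mult_left X'.pair_right)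
  qed (simp_all add: j_def i_add i_scale functional_add [OF X'.pair_functional]
      functional_scale [OF X'.pair_functional])
  then show ?thesis by blast
qed

text \<open>\<open>i a\<close> is the element representing the functional \<open>j a\<close>.
  Equicontinuity of \<open>j\<close> over \<open>B\<close> bounds these elements uniformly on every
  bounded subset of \<open>X\<close>.\<close>

lemma unitized_odd_dual:
  assumes "unitized_odd p X Y S P E G j"
    and X': "dual_pairing X X' bX" and Y': "dual_pairing Y Y' bY"
  shows "\<exists>S' P' E' G' i. unitized_even p X' Y' S' P' E' G' i"
proof -
  interpret unitized_odd p X Y S P E G j by fact
  interpret X': dual_pairing X X' bX by (rule X')
  interpret Y': dual_pairing Y Y' bY by (rule Y')
  obtain S' P' E' G' where U': "unitized X' Y' S' P' E' G'"
    and bP: "\<And>f x. \<lbrakk>f \<in> bm_carrier Y'; x \<in> bm_carrier X\<rbrakk> \<Longrightarrow> bX (P' f) x = bY f (S x)"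
    and G'_eq: "\<And>f. G' f = bY f E"
    using unitized_dual [OF unitized_axioms X' Y'] by blast
  interpret U': unitized X' Y' S' P' E' G' by (rule U')
  have "\<exists>f\<in>bm_carrier X'. \<forall>x\<in>bm_carrier X. bX f x = j a x" for a
    by (rule X'.represented) (rule j_functional)
  then obtain i where i: "\<And>a. i a \<in> bm_carrier X'"
    "\<And>a x. x \<in> bm_carrier X \<Longrightarrow> bX (i a) x = j a x"
    by metis
  have j_zero: "j a (bm_zero X) = 0" for a
    by (rule functional_zero [OF X.lc_space_axioms j_functional])
  \<comment> \<open>Now the action produces a component along \<open>E\<close>; dually it becomes
    the multiple of \<open>i\<close> by the factor \<open>G' y\<close>.\<close>
  have S_right: "bm_right Y (S x) b
      = bm_add Y (S (bm_add X (bm_right X x (algebra_part b)) (bm_scale X (scalar_part b) x)))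
          (bm_scale Y (j (algebra_part b) x) E)"
    and S_left: "bm_left Y b (S x)
      = bm_add Y (S (bm_add X (bm_left X (algebra_part b) x) (bm_scale X (scalar_part b) x)))
          (bm_scale Y (j (algebra_part b) x) E)"
    if "x \<in> bm_carrier X" for x b
    using that by (auto intro!: unitized_eqI simp: P_left P_right G_left G_right
        P_add P_scale G_add G_scale)
  \<comment> \<open>Since \<open>P E\<close> is zero, the algebra part acts on \<open>E\<close> as
    zero.\<close>
  have E_right: "bm_right Y E b = bm_scale Y (scalar_part b) E"
    and E_left: "bm_left Y b E = bm_scale Y (scalar_part b) E" for b
    by (auto intro!: unitized_eqI simp: P_left P_right G_left G_right P_scale G_scale j_zero)
  have "unitized_even p X' Y' S' P' E' G' i"
  proof (intro unitized_even.intro unitized_even_axioms.intro U')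
    fix y b assume y: "y \<in> bm_carrier Y'"
    note lin = functional_add [OF Y'.pair_functional [OF y]]
      functional_scale [OF Y'.pair_functional [OF y]]
      functional_add [OF X'.pair_functional [OF U'.P_closed [OF y]]]
      functional_scale [OF X'.pair_functional [OF U'.P_closed [OF y]]]
    show "P' (bm_left Y' b y) = bm_add X' (bm_add X' (bm_left X' (algebra_part b) (P' y))
        (bm_scale X' (G' y) (i (algebra_part b)))) (bm_scale X' (scalar_part b) (P' y))"
      using y by (intro X'.pair_ext)
        (auto simp: i bP Y'.pair_left S_right X'.pair_add X'.pair_left X'.pair_scale G'_eq S_add S_scale lin)
    show "P' (bm_right Y' y b) = bm_add X' (bm_add X' (bm_right X' (P' y) (algebra_part b))
        (bm_scale X' (G' y) (i (algebra_part b)))) (bm_scale X' (scalar_part b) (P' y))"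
      using y by (intro X'.pair_ext)
        (auto simp: i bP Y'.pair_right S_left X'.pair_add X'.pair_right X'.pair_scale G'_eq S_add S_scale lin)
    show "G' (bm_left Y' b y) = scalar_part b * G' y"
      "G' (bm_right Y' y b) = scalar_part b * G' y"
      using y by (simp_all add: G'_eq Y'.pair_left Y'.pair_right E_left E_right lin)
  next
    fix B assume B: "bm_bounded (regular_bimodule p) B"
    obtain g where g: "dominated X g" "\<forall>a\<in>B. \<forall>x\<in>bm_carrier X. cmod (j a x) \<le> g x"
      using j_bounded [OF B] by blast
    show "bm_bounded X' (i ` B)"
      unfolding bm_bounded_def
    proof (intro conjI ballI)
      fix q assume "q \<in> bm_seminorms X'"
      then obtain F where F: "F \<noteq> {}" "bm_bounded X F"
        and q: "\<And>f. f \<in> bm_carrier X' \<Longrightarrow> q f = (SUP x\<in>F. cmod (bX f x))"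
        using X'.dual_seminorm by meson
      have F': "x \<in> bm_carrier X" if "x \<in> F" for x using F that by (auto simp: bm_bounded_def)
      \<comment> \<open>The bound for \<open>g\<close> on \<open>F\<close> is independent of
        \<open>a\<close> and therefore bounds \<open>q\<close> at every \<open>i a\<close> with
        \<open>a\<close> in \<open>B\<close>.\<close>
      obtain M where M: "\<And>x. x \<in> F \<Longrightarrow> g x \<le> M"
        using dominated_bounded [OF g(1) F(2)] by (auto simp: bdd_above_def)
      have "q (i a) \<le> M" if "a \<in> B" for a
        unfolding q [OF i(1)]
      proof (rule cSUP_least [OF F(1)])
        fix x assume x: "x \<in> F"
        show "cmod (bX (i a) x) \<le> M"
          using g(2) that F' [OF x] M [OF x] by (fastforce simp: i)
      qed
      then show "bdd_above (q ` i ` B)" by (auto simp: bdd_above_def)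
    qed (auto simp: i)
  qed (auto intro!: X'.pair_ext simp: i X'.pair_add X'.pair_scale X'.pair_left X'.pair_right
      j_add j_scale simp flip: j_mult_left j_mult_right)
  then show ?thesis by blast
qed

section \<open>Degree zero and induction on the degree\<close>

lemma scaleC_zero_right [simp]: "scaleC a 0 = (0 :: 'a::complex_algebra)"
  using scaleC_add_right [of a "0 :: 'a" 0] by simp

lemma frechet_submult: "frechet_algebra p \<Longrightarrow> submult_seminorm (p l)"
  by (simp add: frechet_algebra_def)

lemma submult_seminorm_nonneg:
  fixes p :: "nat \<Rightarrow> 'a::complex_algebra \<Rightarrow> real"
  assumes "\<And>l. submult_seminorm (p l)"
  shows "0 \<le> p l x"
proof -
  interpret lc_bimod "regular_bimodule p" by (rule lc_bimod_regular) (rule assms)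
  show ?thesis using seminorm_nonneg [of "p l" x] by simp
qed

lemma submult_unitization_seminorm:
  assumes p: "\<And>l. submult_seminorm (p l)"
  shows "submult_seminorm (unitization_seminorm p l)"
proof -
  have add: "p l (x + y) \<le> p l x + p l y" and scale: "p l (scaleC a x) = cmod a * p l x"
    and mult: "p l (x * y) \<le> p l x * p l y" for x y a
    using p [of l] by (auto simp: submult_seminorm_def)
  have "p l (x * y + scaleC b x + scaleC a y) + cmod (a * b) \<le> (p l x + cmod a) * (p l y + cmod b)"
    for x y a b
  proof -
    have "p l (x * y + scaleC b x + scaleC a y) \<le> p l (x * y) + p l (scaleC b x) + p l (scaleC a y)"
      using add [of "x * y + scaleC b x" "scaleC a y"] add [of "x * y" "scaleC b x"] by simp
    then show ?thesis
      using mult [of x y] by (simp add: scale norm_mult algebra_simps)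
  qed
  moreover have "p l (x + y) + cmod (a + b) \<le> p l x + cmod a + (p l y + cmod b)" for x y a b
    using add [of x y] norm_triangle_ineq [of a b] by simp
  ultimately show ?thesis
    by (simp add: submult_seminorm_def unitization_seminorm_def times_unitization_def
        plus_unitization_def scaleC_unitization_def scale norm_mult distrib_left)
qed

lemma unitization_maps_cont:
  assumes p: "\<And>l. submult_seminorm (p l)"
  shows "cont_linear (regular_bimodule p) (regular_bimodule (unitization_seminorm p))
      (\<lambda>a. Unitization a 0)"
    and "cont_linear (regular_bimodule (unitization_seminorm p)) (regular_bimodule p) algebra_part"
    and "functional (regular_bimodule (unitization_seminorm p)) scalar_part"
proof -
  let ?A = "regular_bimodule p" and ?U = "regular_bimodule (unitization_seminorm p)"
  show "cont_linear ?A ?U (\<lambda>a. Unitization a 0)"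
    unfolding cont_linear_def
  proof (intro conjI ballI)
    fix q assume "q \<in> bm_seminorms ?U"
    then obtain l where l: "q = unitization_seminorm p l" by auto
    have "dominated ?A (p l)" by (rule dominated_seminorm) simp
    then show "dominated ?A (\<lambda>a. q (Unitization a 0))"
      by (rule dominated_le) (simp add: l unitization_seminorm_def)
  qed (simp add: bm_linear_def plus_unitization_def scaleC_unitization_def)
  show "cont_linear ?U ?A algebra_part"
    unfolding cont_linear_def
  proof (intro conjI ballI)
    fix q assume "q \<in> bm_seminorms ?A"
    then obtain l where l: "q = p l" by auto
    have "dominated ?U (unitization_seminorm p l)" by (rule dominated_seminorm) simp
    then show "dominated ?U (\<lambda>a. q (algebra_part a))"
      by (rule dominated_le) (simp add: l unitization_seminorm_def)
  qed (simp add: bm_linear_def plus_unitization_def scaleC_unitization_def)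
  \<comment> \<open>Every seminorm of the unitization bounds the scalar part; index \<open>0\<close>
    is one choice.\<close>
  have "dominated ?U (unitization_seminorm p 0)" by (rule dominated_seminorm) simp
  then have "dominated ?U (\<lambda>a. cmod (scalar_part a))"
    by (rule dominated_le) (use submult_seminorm_nonneg [OF p] in \<open>simp add: unitization_seminorm_def\<close>)
  then show "functional ?U scalar_part"
    by (simp add: functional_iff plus_unitization_def scaleC_unitization_def)
qed

text \<open>In degree zero \<open>i\<close> is the encoding \<open>e\<close>, and the action laws
  are the product of the unitization written in coordinates.\<close>

lemma unitized_even_0:
  fixes p :: "nat \<Rightarrow> 'a::complex_algebra \<Rightarrow> real"
  assumes p: "\<And>l. submult_seminorm (p l)" and e: "inj e" and e': "inj e'"
  shows "\<exists>S P E G i. unitized_even p (rename_bimodule e (regular_bimodule p))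
    (rename_bimodule e' (regular_bimodule (unitization_seminorm p))) S P E G i"
proof -
  let ?A = "regular_bimodule p" and ?U = "regular_bimodule (unitization_seminorm p)"
  let ?X = "rename_bimodule e ?A" and ?Y = "rename_bimodule e' ?U"
  define g where "g = the_inv_into (bm_carrier ?A) e"
  define g' where "g' = the_inv_into (bm_carrier ?U) e'"
  have A: "lc_bimod ?A" and U: "lc_bimod ?U"
    using p by (auto intro!: lc_bimod_regular submult_unitization_seminorm)
  have ge [simp]: "g (e a) = a" "g' (e' b) = b" for a b
    using e e' by (simp_all add: g_def g'_def the_inv_f_f)
  have inj: "inj_on e (bm_carrier ?A)" "inj_on e' (bm_carrier ?U)"
    using e e' by simp_all
  note X = rename_lc_bimod [OF A inj(1), folded g_def]
    and Y = rename_lc_bimod [OF U inj(2), folded g'_def]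
  note simps = rename_simps [OF inj(1)] rename_simps [OF inj(2)]
  have lcs: "lc_space ?A" "lc_space ?U" "lc_space ?X" "lc_space ?Y"
    using A U X(1) Y(1) by (auto simp: lc_bimod_def)
  have zero: "bm_zero ?X = e 0"
    using bm_linear_zero [OF lcs(1,3) cont_linear_linear [OF X(2)]]
    by (simp add: bm_zero_regular [OF p])
  have "unitized_even p ?X ?Y (\<lambda>x. e' (Unitization (g x) 0)) (\<lambda>y. e (algebra_part (g' y)))
      (e' (Unitization 0 1)) (\<lambda>y. scalar_part (g' y)) e"
  proof (intro unitized_even.intro unitized_even_axioms.intro unitized.intro unitized_axioms.intro
      X(1) Y(1))
    show "cont_linear ?X ?Y (\<lambda>x. e' (Unitization (g x) 0))"
      by (rule cont_linear_compose [OF lcs(3) X(3) cont_linear_compose [OF lcs(1)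
            unitization_maps_cont(1) [OF p] Y(2)]])
    show "cont_linear ?Y ?X (\<lambda>y. e (algebra_part (g' y)))"
      by (rule cont_linear_compose [OF lcs(4) Y(3) cont_linear_compose [OF lcs(2)
            unitization_maps_cont(2) [OF p] X(2)]])
    show "functional ?Y (\<lambda>y. scalar_part (g' y))"
      by (rule cont_linear_compose [OF lcs(4) Y(3) unitization_maps_cont(3) [OF p]])
    show "bm_bounded ?X (e ` B)" if "bm_bounded ?A B" for B
      by (rule cont_linear_bounded [OF X(2) that])
  qed (auto simp: simps zero plus_unitization_def scaleC_unitization_def times_unitization_def
      scaleC_zero_left scaleC_zero_right scaleC_one ac_simps)
  then show ?thesis by blast
qed

text \<open>Dualization alternates between the two parities, beginning with the even case.
  Injectivity of the encodings at stage \<open>k\<close> turns the next stage into a dual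
  pairing.\<close>

lemma unitized_iterated_dual:
  fixes p :: "nat \<Rightarrow> 'a::complex_algebra \<Rightarrow> real"
  assumes p: "\<And>l. submult_seminorm (p l)"
    and e: "encodes_duals e c (regular_bimodule p) N"
    and e': "encodes_duals e' c' (regular_bimodule (unitization_seminorm p)) N"
    and "k \<le> N"
  defines "X \<equiv> iterated_dual e c (regular_bimodule p)"
    and "Y \<equiv> iterated_dual e' c' (regular_bimodule (unitization_seminorm p))"
  shows "if even k then \<exists>S P E G i. unitized_even p (X k) (Y k) S P E G i
    else \<exists>S P E G j. unitized_odd p (X k) (Y k) S P E G j"
  using \<open>k \<le> N\<close>
proof (induction k)
  case 0
  then show ?case
    using unitized_even_0 [OF p, of e e'] e e' by (simp add: X_def Y_def encodes_duals_def)
next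
  case (Suc k)
  let ?bX = "the_inv_into (continuous_functionals (X k)) (c k)"
    and ?bY = "the_inv_into (continuous_functionals (Y k)) (c' k)"
  \<comment> \<open>Either invariant contains the bimodule laws needed for the next
    dualization.\<close>
  have XY: "lc_bimod (X k)" "lc_bimod (Y k)"
    using Suc by (auto simp: unitized_def unitized_even_def unitized_odd_def split: if_splits)
  have "inj_on (c k) (continuous_functionals (X k))" "inj_on (c' k) (continuous_functionals (Y k))"
    using e e' Suc.prems by (auto simp: X_def Y_def encodes_duals_def)
  then have d: "dual_pairing (X k) (X (Suc k)) ?bX" "dual_pairing (Y k) (Y (Suc k)) ?bY"
    using XY by (auto simp: X_def Y_def intro!: dual_pairing_rename_strong_dual)
  show ?case
    using Suc unitized_even_dual [OF _ d] unitized_odd_dual [OF _ d] by (auto split: if_splits)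
qed

text \<open>A metrizable space is bornological: otherwise normalizing witnesses \<open>g (a l) > l * p l (a l)\<close>
  gives a bounded sequence on which \<open>g\<close> takes the value \<open>l\<close>.\<close>

lemma bounded_imp_dominated:
  assumes p: "frechet_algebra p"
    and scale: "\<And>c a. g (scaleC c a) = cmod c * g a"
    and bdd: "\<And>B. bm_bounded (regular_bimodule p) B \<Longrightarrow> bdd_above (g ` B)"
  shows "dominated (regular_bimodule p) g"
proof (rule ccontr)
  assume neg: "\<not> ?thesis"
  have nonneg: "0 \<le> p l x" for l x
    using submult_seminorm_nonneg frechet_submult [OF p] by blast
  have "\<exists>a. real l * p l a < g a" for l
  proof (rule ccontr)
    assume "\<nexists>a. real l * p l a < g a"
    then have "dominated (regular_bimodule p) g"
      unfolding dominated_def by (intro exI [of _ "{p l}"] exI [of _ "real l"]) (auto simp: not_less)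
    with neg show False by simp
  qed
  then obtain a where a: "\<And>l. real l * p l (a l) < g (a l)" by metis
  have pos: "0 < g (a l)" for l
    by (rule le_less_trans [OF mult_nonneg_nonneg [OF of_nat_0_le_iff nonneg] a])
  define b where "b l = scaleC (of_real (real l / g (a l))) (a l)" for l
  have gb: "g (b l) = real l" for l
    using pos [of l] by (simp add: b_def scale norm_divide)
  have p_scale: "p m (scaleC c x) = cmod c * p m x" for m c x
    using frechet_submult [OF p, of m] by (simp add: submult_seminorm_def)
  have pb: "p l (b l) \<le> 1" for l
    using pos [of l] a [of l] by (simp add: b_def p_scale norm_divide field_simps)
  have mono: "p m x \<le> p l x" if "m \<le> l" for m l x
    using p by (intro monoD [OF iffD2 [OF mono_iff_le_Suc], OF _ that, of "\<lambda>l. p l x"])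
      (simp add: frechet_algebra_def)
  \<comment> \<open>Monotonicity of the seminorms gives the bound \<open>1\<close> from index
    \<open>m\<close> on; the finitely many earlier terms are covered by the sum.\<close>
  have "p m (b l) \<le> 1 + (\<Sum>k<m. p m (b k))" for m l
  proof (cases "l < m")
    case True
    then show ?thesis
      using member_le_sum [of l "{..<m}" "\<lambda>k. p m (b k)"] by (simp add: nonneg)
  next
    case False
    then show ?thesis
      using mono [of m l "b l"] pb [of l] sum_nonneg [of "{..<m}" "\<lambda>k. p m (b k)"] by (simp add: nonneg)
  qed
  then have "bm_bounded (regular_bimodule p) (range b)"
    by (auto simp: bm_bounded_def bdd_above_def)
  from bdd [OF this] obtain M where "\<And>l. real l \<le> M"
    by (auto simp: bdd_above_def gb)
  then show False
    using reals_Archimedean2 [of M] by (meson not_less)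
qed

section \<open>Derivations into odd duals\<close>

text \<open>The filter of tails, so that limits of nets become limits along a filter.\<close>

definition net_filter :: "('i \<Rightarrow> 'i \<Rightarrow> bool) \<Rightarrow> 'i filter" where
  "net_filter le = (INF j. principal {i. le j i})"

text \<open>Directedness makes the tails a filter base.\<close>

lemma eventually_net_filter:
  assumes "directed_preorder le"
  shows "eventually P (net_filter le) \<longleftrightarrow> (\<exists>j. \<forall>i. le j i \<longrightarrow> P i)"
  unfolding net_filter_def
proof (subst eventually_INF_base)
  fix a b
  obtain k where k: "le a k" "le b k"
    using assms unfolding directed_preorder_def by blast
  have "{i. le k i} \<subseteq> {i. le a i} \<inter> {i. le b i}"
    using assms k unfolding directed_preorder_def by blast
  then show "\<exists>k\<in>UNIV. principal {i. le k i} \<le> inf (principal {i. le a i}) (principal {i. le b i})"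
    by (intro bexI [of _ k]) simp_all
qed (simp_all add: eventually_principal)

lemma net_filter_neq_bot:
  assumes "directed_preorder le"
  shows "net_filter le \<noteq> bot"
proof -
  have "\<not> eventually (\<lambda>_. False) (net_filter le)"
    using assms unfolding eventually_net_filter [OF assms] directed_preorder_def by blast
  then show ?thesis by (simp add: eventually_False)
qed

text \<open>Completeness of the complex numbers, with the Cauchy condition in a convenient form: for
  each radius \<open>f\<close> is eventually near some point, which may change with the
  radius.\<close>

lemma tendsto_Cauchy:
  fixes f :: "'i \<Rightarrow> complex"
  assumes F: "F \<noteq> bot"
    and Cauchy: "\<And>r. 0 < r \<Longrightarrow> \<exists>z. \<forall>\<^sub>F i in F. dist (f i) z < r"
  shows "\<exists>L. (f \<longlongrightarrow> L) F"
proof -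
  have "cauchy_filter (filtermap f F)"
    unfolding cauchy_filter_metric_filtermap
  proof (intro allI impI)
    fix r :: real assume "0 < r"
    then obtain z where z: "\<forall>\<^sub>F i in F. dist (f i) z < r / 2"
      using Cauchy [of "r / 2"] by auto
    then show "\<exists>P. eventually P F \<and> (\<forall>x y. P x \<and> P y \<longrightarrow> dist (f x) (f y) < r)"
      by (intro exI [of _ "\<lambda>i. dist (f i) z < r / 2"]) (auto intro: dist_triangle_half_l dist_commute_lessI)
  qed
  then have "\<exists>L\<in>UNIV. filtermap f F \<le> nhds L"
    using complete_UNIV F unfolding complete_uniform
    by (metis filtermap_bot_iff principal_UNIV top_greatest)
  then show ?thesis by (auto simp: filterlim_def)
qed

text \<open>The dominating finite sum of seminorms tends to zero along \<open>x\<close>. The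
  hypothesis on \<open>x\<close> has the form in which an approximate identity provides it.\<close>

lemma dominated_eventually_small:
  assumes p: "frechet_algebra p" and dir: "directed_preorder le"
    and x: "\<And>l r. 0 < r \<Longrightarrow> \<exists>j. \<forall>i. le j i \<longrightarrow> p l (x i) < r"
    and g: "dominated (regular_bimodule p) g" and r: "0 < r"
  shows "\<forall>\<^sub>F i in net_filter le. g (x i) < r"
proof -
  have nonneg: "0 \<le> p l a" for l a
    using submult_seminorm_nonneg [of p] frechet_submult [OF p] by blast
  obtain F C where F: "finite F" "F \<subseteq> range p" "0 \<le> C" "\<And>a. g a \<le> C * (\<Sum>q\<in>F. q a)"
    using g unfolding dominated_def by auto
  have "((\<lambda>i. p l (x i)) \<longlongrightarrow> 0) (net_filter le)" for l
    using x by (auto simp: tendsto_iff eventually_net_filter [OF dir] nonneg)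
  then have "((\<lambda>i. C * (\<Sum>q\<in>F. q (x i))) \<longlongrightarrow> C * (\<Sum>q\<in>F. 0)) (net_filter le)"
    using F(2) by (intro tendsto_mult tendsto_const tendsto_sum) auto
  then have "\<forall>\<^sub>F i in net_filter le. C * (\<Sum>q\<in>F. q (x i)) < r"
    using r by (intro order_tendstoD(2)) auto
  then show ?thesis
    by (rule eventually_mono) (use F(4) le_less_trans in blast)
qed

section \<open>Transfer of derivations between the algebra and its unitization\<close>

lemma Unitization_decomp:
  "b = Unitization (algebra_part b) 0 + scaleC (scalar_part b) (Unitization 0 1)"
  by (cases b) (simp add: plus_unitization_def scaleC_unitization_def)

lemma continuous_derivation_iff:
  assumes "\<And>l. submult_seminorm (p l)" "lc_space X"
  shows "continuous_derivation p X D \<longleftrightarrow> cont_linear (regular_bimodule p) X D \<and>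
    (\<forall>a b. D (a * b) = bm_add X (bm_left X a (D b)) (bm_right X (D a) b))"
proof -
  interpret A: lc_bimod "regular_bimodule p" by (rule lc_bimod_regular) (rule assms)
  show ?thesis
    unfolding cont_linear_iff [OF A.lc_space_axioms assms(2)]
    by (auto simp: continuous_derivation_def bm_linear_def)
qed

locale unitized_odd_frechet = unitized_odd p X Y S P E G j
  for p :: "nat \<Rightarrow> 'a::complex_algebra \<Rightarrow> real"
    and X :: "('a, 'x) lc_bimodule" and Y :: "('a unitization, 'y) lc_bimodule" and S P E G j +
  fixes le :: "'i \<Rightarrow> 'i \<Rightarrow> bool" and u :: "'i \<Rightarrow> 'a"
  assumes frechet: "frechet_algebra p" and bai: "bounded_approximate_identity p le u"
begin

abbreviation "pU \<equiv> unitization_seminorm p"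

lemma submult: "submult_seminorm (p l)" "submult_seminorm (pU l)"
  using frechet_submult [OF frechet] submult_unitization_seminorm by auto

sublocale A: lc_bimod "regular_bimodule p"
  by (rule lc_bimod_regular) (rule submult)

sublocale U: lc_bimod "regular_bimodule pU"
  by (rule lc_bimod_regular) (rule submult)

lemma directed: "directed_preorder le"
  and approx_left: "0 < r \<Longrightarrow> \<exists>j. \<forall>i. le j i \<longrightarrow> p l (u i * a - a) < r"
  and approx_right: "0 < r \<Longrightarrow> \<exists>j. \<forall>i. le j i \<longrightarrow> p l (a * u i - a) < r"
  using bai by (auto simp: bounded_approximate_identity_def)

lemma bounded_range_u: "bm_bounded (regular_bimodule p) (range u)"
  using bai by (auto simp: bounded_approximate_identity_def bm_bounded_def bdd_above_def)

lemma j_diff: "x \<in> bm_carrier X \<Longrightarrow> j (a - b) x = j a x - j b x"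
  using j_add [of x "a - b" b] by simp

lemma j_zero: "j a (bm_zero X) = 0"
  by (rule functional_zero [OF X.lc_space_axioms j_functional])

text \<open>In the first argument of \<open>j\<close>, \<open>j_bounded\<close> yields boundedness
  on bounded sets; on a Frechet algebra this is continuity, by
  \<open>bounded_imp_dominated\<close>.\<close>

lemma j_dominated:
  assumes x: "x \<in> bm_carrier X"
  shows "dominated (regular_bimodule p) (\<lambda>a. cmod (j a x))"
proof (rule bounded_imp_dominated [OF frechet])
  show "cmod (j (scaleC c a) x) = cmod c * cmod (j a x)" for c a
    using x by (simp add: j_scale norm_mult)
  show "bdd_above ((\<lambda>a. cmod (j a x)) ` B)" if B: "bm_bounded (regular_bimodule p) B" for B
    using j_bounded [OF B] x by (auto simp: bdd_above_def)
qed

text \<open>\<open>f\<close> vanishes at \<open>u i * a\<close>, and these products tend to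
  \<open>a\<close>.\<close>

lemma functional_eq_zero:
  assumes f: "functional (regular_bimodule p) f" and mult: "\<And>a b. f (a * b) = 0"
  shows "f a = 0"
proof -
  have dom: "dominated (regular_bimodule p) (\<lambda>a. cmod (f a))"
    using f by (simp add: functional_iff)
  have "cmod (f a) \<le> r" if "0 < r" for r
  proof -
    have "\<forall>\<^sub>F i in net_filter le. cmod (f (u i * a - a)) < r"
      using approx_left by (intro dominated_eventually_small [OF frechet directed _ dom that])
    moreover have "f (u i * a - a) = - f a" for i
      using functional_add [OF f, of "u i * a - a" a] mult
      by (simp add: add_eq_0_iff) 
    ultimately show ?thesis
      using eventually_happens' [OF net_filter_neq_bot [OF directed]] by fastforce
  qed
  then have "cmod (f a) \<le> 0" by (rule dense_ge)
  then show ?thesis by simp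
qed

text \<open>Boundedness of the approximate identity gives one \<open>g\<close> dominating all
  \<open>j (u i)\<close>. This carries the convergence from products to every element and makes the
  limit continuous.\<close>

lemma extend_derivation_functional:
  assumes D: "cont_linear (regular_bimodule p) X D"
    and mult: "\<And>a b. D (a * b) = bm_add X (bm_left X a (D b)) (bm_right X (D a) b)"
  obtains d where "functional (regular_bimodule p) d"
    and "\<And>a b. d (a * b) = j a (D b) + j b (D a)"
proof -
  define F where "F = net_filter le"
  have F: "F \<noteq> bot" unfolding F_def by (rule net_filter_neq_bot [OF directed])
  note lin = cont_linear_linear [OF D]
  have Dc [simp]: "D a \<in> bm_carrier X" for a
    using bm_linear_closed [OF lin] by simp
  have D_add: "D (a + b) = bm_add X (D a) (D b)" for a b
    using bm_linear_add [OF lin] by simp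
  have D_scale: "D (scaleC c a) = bm_scale X c (D a)" for c a
    using bm_linear_scale [OF lin] by simp
  obtain g where g: "dominated X g" "\<And>i x. x \<in> bm_carrier X \<Longrightarrow> cmod (j (u i) x) \<le> g x"
    using j_bounded [OF bounded_range_u] by auto
  have gD: "dominated (regular_bimodule p) (\<lambda>a. g (D a))"
    by (rule cont_linear_dominated [OF A.lc_space_axioms D g(1)])
  have j_tendsto: "((\<lambda>i. j (y i) x) \<longlongrightarrow> j a x) F"
    if "\<And>l r. 0 < r \<Longrightarrow> \<exists>k. \<forall>i. le k i \<longrightarrow> p l (y i - a) < r" "x \<in> bm_carrier X" for y a x
  proof (rule tendstoI)
    fix r :: real assume "0 < r"
    then have "\<forall>\<^sub>F i in F. cmod (j (y i - a) x) < r"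
      unfolding F_def
      by (intro dominated_eventually_small [OF frechet directed _ j_dominated] that) auto
    then show "\<forall>\<^sub>F i in F. dist (j (y i) x) (j a x) < r"
      using that(2) by (simp add: j_diff dist_norm)
  qed
  have lim_mult: "((\<lambda>i. j (u i) (D (a * b))) \<longlongrightarrow> j a (D b) + j b (D a)) F" for a b
  proof -
    \<comment> \<open>The laws for \<open>j\<close> move both actions into its first argument, where
      \<open>u i * a\<close> tends to \<open>a\<close> and \<open>b * u i\<close> tends to
      \<open>b\<close>.\<close>
    have "j (u i) (D (a * b)) = j (u i * a) (D b) + j (b * u i) (D a)" for i
      by (simp add: mult functional_add [OF j_functional] j_mult_left)
        (simp flip: j_mult_left j_mult_right)
    then show ?thesis
      by (auto intro!: tendsto_add j_tendsto approx_left approx_right)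
  qed
  have "\<exists>L. ((\<lambda>i. j (u i) (D a)) \<longlongrightarrow> L) F" for a
  proof (rule tendsto_Cauchy [OF F])
    fix r :: real assume r: "0 < r"
    \<comment> \<open>The product \<open>u k * a\<close> stands in for \<open>a\<close>: replacing
      one by the other costs less than \<open>r / 2\<close> for all \<open>i\<close> at once, and at
      products convergence is known.\<close>
    have "\<forall>\<^sub>F k in F. g (D (u k * a - a)) < r / 2"
      unfolding F_def using r approx_left
      by (intro dominated_eventually_small [OF frechet directed _ gD]) auto
    then obtain k where k: "g (D (u k * a - a)) < r / 2"
      using eventually_happens' [OF F] by blast
    have close: "dist (j (u i) (D a)) (j (u i) (D (u k * a))) < r / 2" for i
    proof -
      have "D (u k * a) = bm_add X (D (u k * a - a)) (D a)"
        using D_add [of "u k * a - a" a] by simp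
      then have "j (u i) (D (u k * a)) = j (u i) (D (u k * a - a)) + j (u i) (D a)"
        by (simp add: functional_add [OF j_functional])
      then show ?thesis
        using le_less_trans [OF g(2) k] by (simp add: dist_norm norm_minus_commute)
    qed
    \<comment> \<open>The centre is the limit belonging to the product
      \<open>u k * a\<close>.\<close>
    have "\<forall>\<^sub>F i in F. dist (j (u i) (D (u k * a))) (j (u k) (D a) + j a (D (u k))) < r / 2"
      using r by (intro tendstoD [OF lim_mult]) simp
    then have "\<forall>\<^sub>F i in F. dist (j (u i) (D a)) (j (u k) (D a) + j a (D (u k))) < r"
      by (rule eventually_mono) (rule dist_triangle_half_r [OF _ _], use close in \<open>auto simp: dist_commute\<close>)
    then show "\<exists>z. \<forall>\<^sub>F i in F. dist (j (u i) (D a)) z < r" by blast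
  qed
  then obtain d where d: "\<And>a. ((\<lambda>i. j (u i) (D a)) \<longlongrightarrow> d a) F" by metis
  have "d (a + b) = d a + d b" for a b
    using tendsto_unique [OF F d [of "a + b"]] tendsto_add [OF d [of a] d [of b]]
    by (simp add: D_add functional_add [OF j_functional])
  moreover have "d (scaleC c a) = c * d a" for c a
    using tendsto_unique [OF F d [of "scaleC c a"]] tendsto_mult [OF tendsto_const d [of a], of c]
    by (simp add: D_scale functional_scale [OF j_functional])
  \<comment> \<open>The estimate by \<open>g\<close> is uniform in \<open>i\<close> and survives the
    limit.\<close>
  moreover have "cmod (d a) \<le> g (D a)" for a
    by (rule tendsto_upperbound [OF tendsto_norm [OF d] _ F]) (simp add: g(2))
  ultimately have "functional (regular_bimodule p) d"
    using dominated_le [OF gD, of "\<lambda>a. cmod (d a)"] by (simp add: functional_iff)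
  moreover have "d (a * b) = j a (D b) + j b (D a)" for a b
    by (rule tendsto_unique [OF F d lim_mult])
  ultimately show ?thesis by (rule that)
qed

text \<open>The pair of \<open>D\<close> and its functional \<open>d\<close>, extended by zero at
  the identity, is a derivation into \<open>Y\<close>; the formula for \<open>d\<close> on products
  is the \<open>G\<close> coordinate of the product rule. If \<open>y\<close> implements the pair,
  then \<open>P y\<close> implements \<open>D\<close>.\<close>

lemma inner_if_unitization_inner:
  assumes inner: "\<And>D. continuous_derivation pU Y D \<Longrightarrow> inner_derivation Y D"
    and D: "continuous_derivation p X D"
  shows "inner_derivation X D"
proof -
  have D1: "cont_linear (regular_bimodule p) X D"
    and mult: "\<And>a b. D (a * b) = bm_add X (bm_left X a (D b)) (bm_right X (D a) b)"
    using D by (simp_all add: continuous_derivation_iff [OF submult(1) X.lc_space_axioms])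
  obtain d where d: "functional (regular_bimodule p) d"
    "\<And>a b. d (a * b) = j a (D b) + j b (D a)"
    using extend_derivation_functional [OF D1 mult] by blast
  note lin = cont_linear_linear [OF D1]
  have Dc [simp]: "D a \<in> bm_carrier X" for a
    using bm_linear_closed [OF lin] by simp
  have D_add: "D (a + b) = bm_add X (D a) (D b)" for a b
    using bm_linear_add [OF lin] by simp
  have D_scale: "D (scaleC c a) = bm_scale X c (D a)" for c a
    using bm_linear_scale [OF lin] by simp
  have d_add: "d (a + b) = d a + d b" for a b
    using functional_add [OF d(1)] by simp
  have d_scale: "d (scaleC c a) = c * d a" for c a
    using functional_scale [OF d(1)] by simp
  define D' where "D' b = bm_add Y (S (D (algebra_part b))) (bm_scale Y (d (algebra_part b)) E)" for b
  have D'c [simp]: "D' b \<in> bm_carrier Y" for b by (simp add: D'_def)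
  have PD' [simp]: "P (D' b) = D (algebra_part b)" for b
    by (simp add: D'_def P_add P_scale)
  have GD' [simp]: "G (D' b) = d (algebra_part b)" for b
    by (simp add: D'_def G_add G_scale)
  have "cont_linear (regular_bimodule pU) Y D'"
    unfolding cont_linear_def
  proof (intro conjI ballI)
    show "bm_linear (regular_bimodule pU) Y D'"
      unfolding bm_linear_def
      by (auto intro!: unitized_eqI simp: P_add P_scale G_add G_scale plus_unitization_def
          scaleC_unitization_def D_add D_scale d_add d_scale)
    fix q assume q: "q \<in> bm_seminorms Y"
    have "dominated (regular_bimodule p) (\<lambda>a. q (S (D a)))"
      by (rule cont_linear_dominated [OF A.lc_space_axioms D1
            cont_linear_dominated [OF X.lc_space_axioms S dominated_seminorm [OF q]]])
    moreover have "dominated (regular_bimodule p) (\<lambda>a. q E * cmod (d a))"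
      using d(1) q by (intro dominated_cmult) (auto simp: functional_iff Y.seminorm_nonneg)
    ultimately have "dominated (regular_bimodule p) (\<lambda>a. q (S (D a)) + q E * cmod (d a))"
      by (rule A.dominated_add)
    then have "dominated (regular_bimodule p) (\<lambda>a. q (bm_add Y (S (D a)) (bm_scale Y (d a) E)))"
    proof (rule dominated_le)
      fix a
      show "q (bm_add Y (S (D a)) (bm_scale Y (d a) E)) \<le> q (S (D a)) + q E * cmod (d a)"
        using Y.seminorm_add [OF q, of "S (D a)" "bm_scale Y (d a) E"]
        by (simp add: Y.seminorm_scale [OF q] mult.commute)
    qed
    then show "dominated (regular_bimodule pU) (\<lambda>b. q (D' b))"
      unfolding D'_def
      by (rule cont_linear_dominated [OF U.lc_space_axioms unitization_maps_cont(2) [OF submult(1)]])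
  qed
  moreover have "D' (a * b) = bm_add Y (bm_left Y a (D' b)) (bm_right Y (D' a) b)" for a b
  proof (rule unitized_eqI)
    show "P (D' (a * b)) = P (bm_add Y (bm_left Y a (D' b)) (bm_right Y (D' a) b))"
      by (simp add: P_add P_left P_right times_unitization_def D_add D_scale mult
          X.add_assoc X.add_commute X.add_left_commute)
    show "G (D' (a * b)) = G (bm_add Y (bm_left Y a (D' b)) (bm_right Y (D' a) b))"
      by (simp add: G_add G_left G_right times_unitization_def d_add d_scale d(2))
  qed simp_all
  ultimately have "continuous_derivation pU Y D'"
    by (simp add: continuous_derivation_iff [OF submult(2) Y.lc_space_axioms])
  from inner [OF this] obtain y where y: "y \<in> bm_carrier Y"
    "\<And>b. D' b = bm_diff Y (bm_left Y b y) (bm_right Y y b)"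
    by (auto simp: inner_derivation_def)
  \<comment> \<open>In odd degree \<open>P\<close> respects the actions of elements with zero scalar
    part, so it maps commutators to commutators.\<close>
  have "D a = bm_diff X (bm_left X a (P y)) (bm_right X (P y) a)" for a
    using arg_cong [OF y(2), of P "Unitization a 0"] y(1)
    by (simp add: P_diff P_left P_right X.add_scale_0)
  then show ?thesis
    using y(1) unfolding inner_derivation_def by (intro bexI [of _ "P y"]) auto
qed

text \<open>If \<open>x\<close> implements the \<open>P\<close> part of \<open>D\<close> on the
  algebra, then \<open>S x\<close> implements \<open>D\<close>; it remains to see that the
  \<open>G\<close> part vanishes on the algebra and that \<open>D\<close> vanishes at the
  identity.\<close>

lemma unitization_inner_if_inner:
  assumes inner: "\<And>D. continuous_derivation p X D \<Longrightarrow> inner_derivation X D"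
    and D: "continuous_derivation pU Y D"
  shows "inner_derivation Y D"
proof -
  have D1: "cont_linear (regular_bimodule pU) Y D"
    and mult: "\<And>a b. D (a * b) = bm_add Y (bm_left Y a (D b)) (bm_right Y (D a) b)"
    using D by (simp_all add: continuous_derivation_iff [OF submult(2) Y.lc_space_axioms])
  note lin = cont_linear_linear [OF D1]
  have Dc [simp]: "D a \<in> bm_carrier Y" for a
    using bm_linear_closed [OF lin] by simp
  have D_add: "D (a + b) = bm_add Y (D a) (D b)" for a b
    using bm_linear_add [OF lin] by simp
  have D_scale: "D (scaleC c a) = bm_scale Y c (D a)" for c a
    using bm_linear_scale [OF lin] by simp
  define incl where "incl a = Unitization a 0" for a :: 'a
  have incl [simp]: "algebra_part (incl a) = a" "scalar_part (incl a) = 0" for a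
    by (simp_all add: incl_def)
  have incl_mult: "incl (a * b) = incl a * incl b" for a b
    by (simp add: incl_def times_unitization_def)
  have D2: "cont_linear (regular_bimodule p) Y (\<lambda>a. D (incl a))"
    unfolding incl_def
    by (rule cont_linear_compose [OF A.lc_space_axioms unitization_maps_cont(1) [OF submult(1)] D1])
  have P_mult: "P (D (incl (a * b)))
      = bm_add X (bm_left X a (P (D (incl b)))) (bm_right X (P (D (incl a))) b)" for a b
    by (simp add: incl_mult mult P_add P_left P_right X.add_scale_0)
  have "continuous_derivation p X (\<lambda>a. P (D (incl a)))"
    using cont_linear_compose [OF A.lc_space_axioms D2 P] P_mult
    by (simp add: continuous_derivation_iff [OF submult(1) X.lc_space_axioms])
  from inner [OF this] obtain x where x: "x \<in> bm_carrier X"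
    and Px: "\<And>a. P (D (incl a)) = bm_diff X (bm_left X a x) (bm_right X x a)"
    by (auto simp: inner_derivation_def)
  have G0: "G (D (incl a)) = 0" for a
  proof (rule functional_eq_zero)
    show "functional (regular_bimodule p) (\<lambda>a. G (D (incl a)))"
      by (rule cont_linear_compose [OF A.lc_space_axioms D2 G])
    fix a b
    have "G (D (incl (a * b))) = j a (P (D (incl b))) + j b (P (D (incl a)))"
      by (simp add: incl_mult mult G_add G_left G_right)
    \<comment> \<open>Each \<open>j\<close> term becomes a commutator of \<open>a\<close> and
      \<open>b\<close> evaluated at \<open>x\<close>, and the two have opposite signs.\<close>
    also have "\<dots> = j (a * b) x - j (b * a) x + (j (b * a) x - j (a * b) x)"
      using x by (simp add: Px functional_diff [OF X.lc_space_axioms j_functional])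
        (simp flip: j_mult_left j_mult_right)
    finally show "G (D (incl (a * b))) = 0" by simp
  qed
  define one where "one = (Unitization 0 1 :: 'a unitization)"
  have one [simp]: "algebra_part one = 0" "scalar_part one = 1" "one * one = one"
    by (simp_all add: one_def times_unitization_def)
  \<comment> \<open>At the identity the algebra part acts as zero and the scalar part as one, so the
    product rule doubles the value.\<close>
  have "P (D one) = bm_add X (P (D one)) (P (D one))"
    using arg_cong [OF mult [of one one], of P]
    by (simp add: P_add P_left P_right X.zero_left X.zero_right X.scale_one)
  then have P1: "P (D one) = bm_zero X"
    by (intro X.add_self_eq_zero) simp_all
  \<comment> \<open>The \<open>j\<close> terms drop out because \<open>P (D one)\<close> is already
    known to be zero.\<close>
  have "G (D one) = G (D one) + G (D one)"
    using arg_cong [OF mult [of one one], of G] by (simp add: G_add G_left G_right P1 j_zero)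
  then have G1: "G (D one) = 0" by simp
  have D_eq: "D b = bm_add Y (D (incl (algebra_part b))) (bm_scale Y (scalar_part b) (D one))" for b
    using Unitization_decomp [of b] by (metis D_add D_scale incl_def one_def)
  have "D b = bm_diff Y (bm_left Y b (S x)) (bm_right Y (S x) b)" for b
  proof (rule unitized_eqI)
    have "P (D b) = P (D (incl (algebra_part b)))"
      by (subst D_eq) (simp add: P_add P_scale P1)
    then show "P (D b) = P (bm_diff Y (bm_left Y b (S x)) (bm_right Y (S x) b))"
      using x by (simp add: Px P_diff P_left P_right X.diff_add_same)
    have "G (D b) = 0"
      by (subst D_eq) (simp add: G_add G_scale G0 G1)
    \<comment> \<open>Left and right actions have the same \<open>G\<close> coordinate, so every
      commutator in \<open>Y\<close> has coordinate zero.\<close>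
    then show "G (D b) = G (bm_diff Y (bm_left Y b (S x)) (bm_right Y (S x) b))"
      using x by (simp add: G_diff G_left G_right)
  qed (use x in simp_all)
  then show ?thesis
    using x unfolding inner_derivation_def by (intro bexI [of _ "S x"]) auto
qed

end

theorem corollary3p15:
  fixes p :: "nat \<Rightarrow> 'a::complex_algebra \<Rightarrow> real"
    and le :: "'i \<Rightarrow> 'i \<Rightarrow> bool" and u :: "'i \<Rightarrow> 'a"
    and e :: "'a \<Rightarrow> 'u" and c :: "nat \<Rightarrow> ('u \<Rightarrow> complex) \<Rightarrow> 'u"
    and e' :: "'a unitization \<Rightarrow> 'v" and c' :: "nat \<Rightarrow> ('v \<Rightarrow> complex) \<Rightarrow> 'v"
    and n :: nat
  assumes "frechet_algebra p"
    and "bounded_approximate_identity p le u"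
    and "n \<ge> 1"
    and "encodes_duals e c (regular_bimodule p) (2 * n + 1)"
    and "encodes_duals e' c' (regular_bimodule (unitization_seminorm p)) (2 * n + 1)"
  shows "weakly_amenable e' c' (2 * n + 1) (unitization_seminorm p) \<longleftrightarrow>
         weakly_amenable e c (2 * n + 1) p"
proof -
  let ?X = "iterated_dual e c (regular_bimodule p) (2 * n + 1)"
  let ?Y = "iterated_dual e' c' (regular_bimodule (unitization_seminorm p)) (2 * n + 1)"
  \<comment> \<open>The degree is odd, which selects the odd invariant.\<close>
  obtain S P E G j where "unitized_odd p ?X ?Y S P E G j"
    using unitized_iterated_dual [OF frechet_submult [OF assms(1)] assms(4,5) order_refl]
    by (auto simp del: iterated_dual.simps split: if_splits)
  then interpret unitized_odd_frechet p ?X ?Y S P E G j le u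
    by (intro unitized_odd_frechet.intro unitized_odd_frechet_axioms.intro assms(1,2))
  show ?thesis
    using inner_if_unitization_inner unitization_inner_if_inner
    unfolding weakly_amenable_def by blast
qed

end
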